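(* Let $\Gamma$ be a distance-regular graph with classical parameters $(D,b,\alpha,\beta)$ such that $b\in\{1,2,\dots,100\}$ and $D\geq 14$. Then: (i) if $b$ is not a perfect square, then $\alpha\leq b$; (ii) if $b$ is a perfect square, then $\alpha\leq b$ or $\alpha=b+\sqrt{b}$.
   Context: All graphs are finite, undirected and simple. A connected graph $\Gamma$ of diameter $D$ is distance-regular if for each $0\le i\le D$ there are integers $b_i,c_i$ such that for any two vertices $x,y$ at distance $i$, exactly $c_i$ neighbours of $y$ are at distance $i-1$ from $x$ and exactly $b_i$ neighbours of $y$ are at distance $i+1$ from $x$. Write $\left[\begin{smallmatrix} i\\ 1\end{smallmatrix}\right]_b=1+b+\dots+b^{i-1}$. A distance-regular graph of diameter $D$ has classical parameters $(D,b,\alpha,\beta)$ if for all $0\le i\le D$: $c_i=\left[\begin{smallmatrix} i\\ 1\end{smallmatrix}\right]_b\bigl(1+\alpha\left[\begin{smallmatrix} i-1\\ 1\end{smallmatrix}\right]_b\bigr)$ and $b_i=\bigl(\left[\begin{smallmatrix} D\\ 1\end{smallmatrix}\right]_b-\left[\begin{smallmatrix} i\\ 1\end{smallmatrix}\right]_b\bigr)\bigl(\beta-\alpha\left[\begin{smallmatrix} i\\ 1\end{smallmatrix}\right]_b\bigr)$. *)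

theory Defs
  imports
    Complex_Main
    "HOL-Computational_Algebra.Nth_Powers"
    "Graph_Theory.Graph_Theory"
begin

text \<open>
  Finite undirected simple graphs are represented by the locale predicate \<open>pair_graph\<close> of
  \<open>Graph_Theory\<close>: finitely many vertices, and a symmetric irreflexive arc relation on them,
  so that every undirected edge appears as two opposite arcs.
\<close>

definition graph_dist :: "'a pair_pre_digraph \<Rightarrow> 'a \<Rightarrow> 'a \<Rightarrow> nat" where
  "graph_dist G x y = (LEAST n. \<exists>p. pre_digraph.awalk (with_proj G) x p y \<and> length p = n)"

text \<open>
  On reachable pairs this is the library's shortest-path cost for unit arc costs; only on
  unreachable pairs, which do not occur in a connected graph, is its value unspecified.
\<close>

lemma graph_dist_eq_mu:
  assumes "pair_wf_digraph G" and reach: "x \<rightarrow>\<^sup>*\<^bsub>with_proj G\<^esub> y"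
  shows "wf_digraph.\<mu> (with_proj G) (\<lambda>_. 1) x y = ereal (real (graph_dist G x y))"
proof -
  interpret pair_wf_digraph G by fact
  have cost: "awalk_cost (\<lambda>_. 1) p = real (length p)" for p
    by (induction p) simp_all
  have "\<exists>n p. awalk x p y \<and> length p = n"
    using reach unfolding reachable_awalk by blast
  then have "\<exists>p. awalk x p y \<and> length p = graph_dist G x y"
    unfolding graph_dist_def by (rule LeastI_ex)
  then obtain p where p: "awalk x p y" "length p = graph_dist G x y"
    by blast
  have le: "graph_dist G x y \<le> length q" if "awalk x q y" for q
    unfolding graph_dist_def using that by (blast intro: Least_le)
  show ?thesis
    unfolding \<mu>_def cost
  proof (rule antisym)
    show "(INF q\<in>{q. awalk x q y}. ereal (real (length q))) \<le> ereal (real (graph_dist G x y))"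
      by (rule INF_lower2[of p]) (simp_all add: p)
    show "ereal (real (graph_dist G x y)) \<le> (INF q\<in>{q. awalk x q y}. ereal (real (length q)))"
      by (rule INF_greatest) (simp add: le)
  qed
qed

definition graph_diameter :: "'a pair_pre_digraph \<Rightarrow> nat" where
  "graph_diameter G = Max {graph_dist G x y | x y. x \<in> pverts G \<and> y \<in> pverts G}"

definition neighbours :: "'a pair_pre_digraph \<Rightarrow> 'a \<Rightarrow> 'a set" where
  "neighbours G y = {z \<in> pverts G. (y, z) \<in> parcs G}"

text \<open>
  In the first count, \<open>Suc (graph_dist G x z) = i\<close> expresses ``distance \<open>i - 1\<close>'' without
  truncated subtraction, so that no vertex qualifies when \<open>i = 0\<close>.
\<close>

definition has_intersection_numbers ::
    "'a pair_pre_digraph \<Rightarrow> (nat \<Rightarrow> int) \<Rightarrow> (nat \<Rightarrow> int) \<Rightarrow> bool" where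
  "has_intersection_numbers G bs cs \<longleftrightarrow>
     (\<forall>i \<le> graph_diameter G. \<forall>x \<in> pverts G. \<forall>y \<in> pverts G. graph_dist G x y = i \<longrightarrow>
        int (card {z \<in> neighbours G y. Suc (graph_dist G x z) = i}) = cs i \<and>
        int (card {z \<in> neighbours G y. graph_dist G x z = Suc i}) = bs i)"

definition distance_regular :: "'a pair_pre_digraph \<Rightarrow> bool" where
  "distance_regular G \<longleftrightarrow>
     pair_graph G \<and> Digraph_Component.connected (with_proj G) \<and>
     (\<exists>bs cs. has_intersection_numbers G bs cs)"

definition gauss1 :: "int \<Rightarrow> nat \<Rightarrow> real" where
  "gauss1 b i = (\<Sum>k<i. real_of_int b ^ k)"

text \<open>
  For \<open>i = 0\<close> the formula for \<open>c\<^sub>i\<close> mentions the index \<open>i - 1\<close>, but its other factor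
  \<open>gauss1 b 0\<close> vanishes, so truncated subtraction is harmless. In a connected graph every
  \<open>i\<close> up to the diameter occurs as a distance, so the intersection numbers are unique in this
  range.
\<close>

definition has_classical_parameters ::
    "'a pair_pre_digraph \<Rightarrow> nat \<Rightarrow> int \<Rightarrow> real \<Rightarrow> real \<Rightarrow> bool" where
  "has_classical_parameters G D b \<alpha> \<beta> \<longleftrightarrow>
     distance_regular G \<and> graph_diameter G = D \<and>
     (\<exists>bs cs. has_intersection_numbers G bs cs \<and>
        (\<forall>i \<le> D.
           real_of_int (cs i) = gauss1 b i * (1 + \<alpha> * gauss1 b (i - 1)) \<and>
           real_of_int (bs i) = (gauss1 b D - gauss1 b i) * (\<beta> - \<alpha> * gauss1 b i)))"

end

theory Submission
  imports Defs "HOL-Number_Theory.Residues"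
begin

text \<open>
  Counting the vertices at distance $j$ from both ends of a geodesic of length $2j$ gives
  $c_1 \cdots c_j \mid c_{j+1} \cdots c_{2j}$ for $2j \le D$. With classical parameters every $c_i$ is
  determined by $b$ and $C = c_2 = (1+b)(1+\alpha)$, and reducing these divisibilities modulo $C$, modulo
  $C - b$ (a factor of $c_3$) and modulo the linear factor of $c_{u+1}$ bounds each modulus by an
  explicit multiple of it that depends on $b$ only. So $C$ runs through the divisors of
  $b^2 (1+b)^2 (1+b+b^2)(1+b^2)$, and for $b \le 100$ a finite search shows that the remaining
  divisibilities fail unless $C \le (1+b)^2$ or $C = (1+b)(1+b+\sqrt b)$.

  To keep the search short, divisors are represented by their discrete logarithms modulo small primes $m$:
  as soon as the logarithm of $C$ modulo $m$ equals that of the residue class on which some linear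
  factor vanishes, while $m$ does not divide its multiple, $C$ is impossible.
\<close>

section \<open>Counting geodesics\<close>

text \<open>The search is for the integer \<open>C\<close> because alpha itself need not be an
  integer. The reductions rest on \<open>geo b (u + k) = geo b u + b ^ u * geo b k\<close>: modulo
  the linear factor with index \<open>u\<close>, a later linear factor times \<open>geo b u\<close>
  becomes \<open>- ((1 + b) * b ^ u * geo b k)\<close>, from which \<open>C\<close> has disappeared.
  Up to 2 * 7 = 14 intersection numbers are used, which is where the diameter bound enters, and
  \<open>u\<close> therefore runs up to 6. The obstacle is the cost. The search is evaluated by
  rewriting with \<open>code_simp\<close>, the divisors of a number of order b^8 are numerous, and
  testing a divisibility between the large numbers involved is expensive. Logarithms turn the
  formation of divisors into additions of small numbers and their rejection into table lookups; only
  the survivors are tested directly. This is also why so many functions are first-order recursions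
  over explicit patterns.\<close>

context pair_graph
begin

lemma ex_shortest_awalk:
  assumes "x \<rightarrow>\<^sup>*\<^bsub>with_proj G\<^esub> y"
  shows "\<exists>p. awalk x p y \<and> length p = graph_dist G x y"
proof -
  have "\<exists>n p. awalk x p y \<and> length p = n" using assms unfolding reachable_awalk by blast
  then show ?thesis unfolding graph_dist_def by (rule LeastI_ex)
qed

lemma graph_dist_le: "awalk x p y \<Longrightarrow> graph_dist G x y \<le> length p"
  unfolding graph_dist_def by (blast intro: Least_le)

end

locale connected_pair_graph = pair_graph G for G :: "'a pair_pre_digraph" +
  assumes conn: "Digraph_Component.connected (with_proj G)"
begin

lemma reach: "x \<in> pverts G \<Longrightarrow> y \<in> pverts G \<Longrightarrow> x \<rightarrow>\<^sup>*\<^bsub>with_proj G\<^esub> y"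
  using conn reachable_mk_symmetric_eq[OF sym_arcs] by (simp add: connected_def strongly_connected_def)

lemma verts_nonempty: "pverts G \<noteq> {}"
  using conn by (simp add: connected_def strongly_connected_def)

lemma dist_triangle:
  assumes "x \<in> pverts G" "y \<in> pverts G" "z \<in> pverts G"
  shows "graph_dist G x z \<le> graph_dist G x y + graph_dist G y z"
proof -
  obtain p where p: "awalk x p y" "length p = graph_dist G x y"
    using ex_shortest_awalk[OF reach[OF assms(1,2)]] by (elim exE conjE)
  obtain q where q: "awalk y q z" "length q = graph_dist G y z"
    using ex_shortest_awalk[OF reach[OF assms(2,3)]] by (elim exE conjE)
  show ?thesis using graph_dist_le[OF awalk_appendI[OF p(1) q(1)]] p(2) q(2) by simp
qed

lemma neighboursD:
  assumes "z \<in> neighbours G y"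
  shows "z \<in> pverts G" "y \<in> pverts G" "graph_dist G y z \<le> 1" "graph_dist G z y \<le> 1"
proof -
  have z: "z \<in> pverts G" "(y, z) \<in> parcs G" using assms by (auto simp: neighbours_def)
  then have a: "(z, y) \<in> parcs G" using arcs_symmetric[of y z] by simp
  show "z \<in> pverts G" by (rule z)
  show "y \<in> pverts G" using z(2) in_arcsD1 by blast
  have "awalk y [(y, z)] z" "awalk z [(z, y)] y" using z a \<open>y \<in> pverts G\<close>
    by (auto simp: awalk_Cons_iff awalk_Nil_iff)
  from this[THEN graph_dist_le] show "graph_dist G y z \<le> 1" "graph_dist G z y \<le> 1" by simp_all
qed

lemma dist_eq_0_iff: "x \<in> pverts G \<Longrightarrow> y \<in> pverts G \<Longrightarrow> graph_dist G x y = 0 \<longleftrightarrow> x = y"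
proof
  assume v: "x \<in> pverts G" "y \<in> pverts G"
  { assume "graph_dist G x y = 0"
    then show "x = y" using ex_shortest_awalk[OF reach[OF v]] by (auto simp: awalk_Nil_iff) }
  { assume "x = y"
    then show "graph_dist G x y = 0" using graph_dist_le[of x "[]" y] v by (simp add: awalk_Nil_iff) }
qed

lemma ex_closer_neighbour:
  assumes "x \<in> pverts G" "y \<in> pverts G" "graph_dist G x y = Suc n"
  shows "\<exists>z\<in>neighbours G y. graph_dist G x z = n"
proof -
  obtain p where p: "awalk x p y" "length p = Suc n" using ex_shortest_awalk[OF reach[OF assms(1,2)]] assms(3) by auto
  from p(2) obtain q e where pq: "p = q @ [e]" by (cases p rule: rev_cases) simp_all
  obtain z w where e: "e = (z, w)" by (cases e)
  have "awalk x q z" "w = y" "(z, y) \<in> parcs G" "z \<in> pverts G"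
    using p(1) unfolding pq e by (auto simp: awalk_Cons_iff awalk_Nil_iff)
  then have z: "z \<in> neighbours G y" "graph_dist G x z \<le> n"
    using graph_dist_le[of x q z] p(2) pq arcs_symmetric[of z y] by (auto simp: neighbours_def)
  moreover have "Suc n \<le> graph_dist G x z + 1"
    using dist_triangle[OF assms(1) neighboursD(1)[OF z(1)] assms(2)] neighboursD(4)[OF z(1)] assms(3) by simp
  ultimately show ?thesis by (intro bexI[of _ z]) auto
qed

text \<open>From a pair at maximal distance, \<open>ex_closer_neighbour\<close> lowers the distance
  by exactly one per step, so no value is skipped.\<close>

lemma ex_dist: "n \<le> graph_diameter G \<Longrightarrow> \<exists>x\<in>pverts G. \<exists>y\<in>pverts G. graph_dist G x y = n"
proof -
  let ?S = "{graph_dist G x y | x y. x \<in> pverts G \<and> y \<in> pverts G}"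
  have "?S = (\<lambda>(x, y). graph_dist G x y) ` (pverts G \<times> pverts G)" by auto
  moreover have "finite (pverts G)" using finite_verts by simp
  ultimately have "finite ?S" "?S \<noteq> {}" using verts_nonempty by auto
  then have "Max ?S \<in> ?S" by (rule Max_in)
  then obtain x y where xy: "x \<in> pverts G" "y \<in> pverts G" "graph_dist G x y = graph_diameter G"
    unfolding graph_diameter_def by auto
  have "\<exists>z\<in>pverts G. graph_dist G x z = graph_diameter G - k" if "k \<le> graph_diameter G" for k
    using that
  proof (induction k)
    case 0
    then show ?case using xy by auto
  next
    case (Suc k)
    then obtain z where z: "z \<in> pverts G" "graph_dist G x z = graph_diameter G - k" by auto
    then have "graph_dist G x z = Suc (graph_diameter G - Suc k)" using Suc.prems by simp
    then show ?case using ex_closer_neighbour[OF xy(1) z(1)] neighboursD(1) by blast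
  qed
  from this[of "graph_diameter G - n"] xy(1) show "n \<le> graph_diameter G \<Longrightarrow> ?thesis" by auto
qed

lemma card_closer:
  assumes "has_intersection_numbers G bs cs" "x \<in> pverts G" "y \<in> pverts G" "graph_dist G x y = i" "i \<le> graph_diameter G"
  shows "int (card {z \<in> neighbours G y. Suc (graph_dist G x z) = i}) = cs i"
  using assms unfolding has_intersection_numbers_def by blast

lemma c_pos:
  assumes "has_intersection_numbers G bs cs" "0 < i" "i \<le> graph_diameter G"
  shows "cs i > 0"
proof -
  obtain n where n: "i = Suc n" using assms(2) by (cases i) auto
  obtain x y where xy: "x \<in> pverts G" "y \<in> pverts G" "graph_dist G x y = i" using ex_dist assms(3) by blast
  obtain z where z: "z \<in> neighbours G y" "graph_dist G x z = n" using ex_closer_neighbour xy n by blast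
  have "int (card {z \<in> neighbours G y. Suc (graph_dist G x z) = i}) = cs i"
    using card_closer[OF assms(1) xy assms(3)] .
  moreover have "finite (neighbours G y)" unfolding neighbours_def using finite_verts by simp
  then have "card {z \<in> neighbours G y. Suc (graph_dist G x z) = i} > 0"
    using z n by (auto simp: card_gt_0_iff)
  ultimately show ?thesis by linarith
qed

text \<open>Two vertices at distance n are joined by c_1 ... c_n geodesics, and each of them has
  exactly one vertex \<open>z\<close> at distance \<open>i\<close> from \<open>x\<close>, which cuts
  it into geodesics of lengths \<open>i\<close> and \<open>j\<close>. The induction on
  \<open>j\<close> does this count without introducing geodesics.\<close>

lemma prod_c_eq:
  assumes I: "has_intersection_numbers G bs cs"
  shows "\<lbrakk>x \<in> pverts G; y \<in> pverts G; graph_dist G x y = i + j; i + j \<le> graph_diameter G\<rbrakk> \<Longrightarrow>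
    (\<Prod>k=1..i + j. cs k) = (\<Prod>k=1..i. cs k) * (\<Prod>k=1..j. cs k) *
      int (card {z \<in> pverts G. graph_dist G x z = i \<and> graph_dist G z y = j})"
proof (induction j arbitrary: y)
  case 0
  then have "{z \<in> pverts G. graph_dist G x z = i \<and> graph_dist G z y = 0} = {y}"
    by (auto simp: dist_eq_0_iff)
  then show ?case by simp
next
  case (Suc j)
  let ?A = "\<lambda>y j. {z \<in> pverts G. graph_dist G x z = i \<and> graph_dist G z y = j}"
  let ?P = "{w \<in> neighbours G y. Suc (graph_dist G x w) = Suc (i + j)}"
  let ?Q = "\<lambda>z. {w \<in> neighbours G y. Suc (graph_dist G z w) = Suc j}"
  have fin: "finite (pverts G)" "finite (neighbours G y)" using finite_verts by (auto simp: neighbours_def)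
  have cP: "int (card ?P) = cs (Suc (i + j))"
    using Suc.prems by (intro card_closer[OF I]) simp_all
  have cQ: "int (card (?Q z)) = cs (Suc j)" if "z \<in> ?A y (Suc j)" for z
    using Suc.prems that by (intro card_closer[OF I]) simp_all
  have IH: "(\<Prod>k=1..i + j. cs k) = (\<Prod>k=1..i. cs k) * (\<Prod>k=1..j. cs k) * int (card (?A w j))" if "w \<in> ?P" for w
    using Suc.IH[of w] Suc.prems that neighboursD(1)[of w y] by simp
  \<comment> \<open>Double counting: \<open>w\<close> is a neighbour of \<open>y\<close> one step
    nearer to \<open>x\<close>, and \<open>z\<close> lies between \<open>x\<close> and
    \<open>w\<close>. By the triangle inequality the same pairs arise whether \<open>w\<close> or
    \<open>z\<close> is chosen first.\<close>
  have sw: "(SIGMA w:?P. ?A w j) = (\<lambda>(z, w). (w, z)) ` (SIGMA z:?A y (Suc j). ?Q z)" (is "?L = ?R")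
  proof (intro equalityI subsetI)
    fix q assume "q \<in> ?L"
    then obtain w z where q: "q = (w, z)" "w \<in> ?P" "z \<in> ?A w j" by auto
    have w: "w \<in> pverts G" "graph_dist G w y \<le> 1" using q neighboursD[of w y] by auto
    have "graph_dist G z y \<le> Suc j" using dist_triangle[of z w y] q w Suc.prems by auto
    moreover have "i + Suc j \<le> i + graph_dist G z y" using dist_triangle[of x z y] q Suc.prems by auto
    ultimately show "q \<in> ?R" using q by (auto intro!: image_eqI[of _ _ "(z, w)"])
  next
    fix q assume "q \<in> ?R"
    then obtain w z where q: "q = (w, z)" "z \<in> ?A y (Suc j)" "w \<in> ?Q z" by auto
    have w: "w \<in> pverts G" "graph_dist G w y \<le> 1" using q neighboursD[of w y] by auto
    have "graph_dist G x w \<le> i + j" using dist_triangle[of x z w] q w Suc.prems by auto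
    moreover have "i + Suc j \<le> graph_dist G x w + 1" using dist_triangle[of x w y] w Suc.prems by auto
    ultimately show "q \<in> ?L" using q by auto
  qed
  have "card ?L = card (SIGMA z:?A y (Suc j). ?Q z)"
    unfolding sw by (rule card_image) (auto simp: inj_on_def)
  then have "int (\<Sum>w\<in>?P. card (?A w j)) = int (\<Sum>z\<in>?A y (Suc j). card (?Q z))"
    using fin by (simp add: card_SigmaI)
  then have count: "(\<Sum>w\<in>?P. int (card (?A w j))) = int (card (?A y (Suc j))) * cs (Suc j)"
    using cQ by simp
  have "cs (Suc (i + j)) * (\<Prod>k=1..i + j. cs k) = (\<Sum>w\<in>?P. \<Prod>k=1..i + j. cs k)"
    by (simp add: cP[symmetric])
  also have "\<dots> = (\<Sum>w\<in>?P. (\<Prod>k=1..i. cs k) * (\<Prod>k=1..j. cs k) * int (card (?A w j)))"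
    by (rule sum.cong) (use IH in auto)
  also have "\<dots> = (\<Prod>k=1..i. cs k) * (\<Prod>k=1..j. cs k) * (int (card (?A y (Suc j))) * cs (Suc j))"
    by (simp only: sum_distrib_left[symmetric] count)
  finally show ?case by (simp add: mult_ac)
qed

lemma prod_c_dvd:
  assumes I: "has_intersection_numbers G bs cs" and "2 * j \<le> graph_diameter G"
  shows "(\<Prod>k=1..j. cs k) dvd (\<Prod>k=j + 1..2 * j. cs k)"
proof -
  obtain x y where xy: "x \<in> pverts G" "y \<in> pverts G" "graph_dist G x y = j + j"
    using ex_dist[of "j + j"] assms(2) by auto
  have split: "(\<Prod>k=1..j + j. cs k) = (\<Prod>k=1..j. cs k) * (\<Prod>k=j + 1..j + j. cs k)"
    by (subst prod.union_disjoint[symmetric]) (auto intro: prod.cong)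
  \<comment> \<open>Positivity allows one factor c_1 ... c_j to be cancelled from the count with
    \<open>i = j\<close>.\<close>
  have "(\<Prod>k=1..j. cs k) > 0" using c_pos[OF I] assms(2) by (intro prod_pos) auto
  moreover have "(\<Prod>k=1..j. cs k) * (\<Prod>k=j + 1..j + j. cs k) =
      (\<Prod>k=1..j. cs k) * ((\<Prod>k=1..j. cs k) * int (card {z \<in> pverts G. graph_dist G x z = j \<and> graph_dist G z y = j}))"
    using prod_c_eq[OF I xy] assms(2) unfolding split mult.assoc by simp
  ultimately have "(\<Prod>k=j + 1..j + j. cs k) =
      (\<Prod>k=1..j. cs k) * int (card {z \<in> pverts G. graph_dist G x z = j \<and> graph_dist G z y = j})"
    unfolding mult_cancel_left by (elim disjE) (simp_all only: less_irrefl)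
  then show ?thesis unfolding mult_2 by (rule dvdI)
qed

end

section \<open>Arithmetic on binary numerals\<close>

text \<open>Keys are read digit by digit, least significant first, so a lookup is a short chain of
  constructor matches.\<close>

datatype 'a trie = Tip | Bin "'a option" "'a trie" "'a trie"

fun look :: "'a trie \<Rightarrow> num \<Rightarrow> 'a option" where
  "look Tip k = None"
| "look (Bin x l r) num.One = x"
| "look (Bin x l r) (num.Bit0 k) = look l k"
| "look (Bin x l r) (num.Bit1 k) = look r k"

fun ins :: "num \<Rightarrow> 'a \<Rightarrow> 'a trie \<Rightarrow> 'a trie" where
  "ins num.One y Tip = Bin (Some y) Tip Tip"
| "ins (num.Bit0 k) y Tip = Bin None (ins k y Tip) Tip"
| "ins (num.Bit1 k) y Tip = Bin None Tip (ins k y Tip)"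
| "ins num.One y (Bin x l r) = Bin (Some y) l r"
| "ins (num.Bit0 k) y (Bin x l r) = Bin x (ins k y l) r"
| "ins (num.Bit1 k) y (Bin x l r) = Bin x l (ins k y r)"

lemma look_ins: "look (ins k y t) k' = (if k' = k then Some y else look t k')"
  by (induction k y t arbitrary: k' rule: ins.induct; case_tac k'; simp)

text \<open>Nonpositive integers go to \<open>num.One\<close>, so results are meaningful for
  positive arguments only.\<close>

definition to_num :: "int \<Rightarrow> num" where "to_num x = num_of_nat (nat x)"

lemma to_num_code [code]:
  "to_num 0 = num.One" "to_num (Int.Pos n) = n" "to_num (Int.Neg n) = num.One"
  by (simp_all add: to_num_def num_of_nat_numeral_eq)

lemma numeral_to_num: "x > 0 \<Longrightarrow> numeral (to_num x) = x"
proof -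
  assume "x > 0"
  then have "(numeral (num_of_nat (nat x)) :: nat) = nat x"
    by (simp add: numeral_num_of_nat)
  then have "int (numeral (num_of_nat (nat x))) = x" using \<open>x > 0\<close> by simp
  then show ?thesis by (simp add: to_num_def)
qed

lemma to_num_numeral [simp]: "to_num (numeral k) = k"
  by (simp add: to_num_def num_of_nat_numeral_eq)

text \<open>Horner's scheme from the leading digit: the remainder stays below \<open>m\<close>, so
  doubling it and adding a digit gives at most 2m - 1, and one subtraction suffices.\<close>

fun mod_num :: "int \<Rightarrow> num \<Rightarrow> int" where
  "mod_num m num.One = 1"
| "mod_num m (num.Bit0 n) = (let y = 2 * mod_num m n in if y < m then y else y - m)"
| "mod_num m (num.Bit1 n) = (let y = 2 * mod_num m n + 1 in if y < m then y else y - m)"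

definition rem :: "int \<Rightarrow> int \<Rightarrow> int" where
  "rem m x = (if x \<le> 0 then 0 else mod_num m (to_num x))"

lemma mod_num_eq: "m > 1 \<Longrightarrow> mod_num m n = numeral n mod m"
proof (induction n)
  case One
  then show ?case by simp
next
  case (Bit0 n)
  let ?r = "numeral n mod m"
  have "numeral (num.Bit0 n) mod m = (2 * ?r) mod m"
    by (metis mod_mult_right_eq mult_2 numeral_Bit0)
  also have "\<dots> = (if 2 * ?r < m then 2 * ?r else 2 * ?r - m)"
  proof (cases "2 * ?r < m")
    case True
    then show ?thesis using Bit0.prems by simp
  next
    case False
    have "(2 * ?r) mod m = (2 * ?r - m) mod m" by simp
    also have "\<dots> = 2 * ?r - m"
      using False Bit0.prems pos_mod_bound[of m "numeral n"] by (intro mod_pos_pos_trivial) auto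
    finally show ?thesis using False by simp
  qed
  finally show ?case using Bit0 by (simp add: Let_def)
next
  case (Bit1 n)
  let ?r = "numeral n mod m"
  have "numeral (num.Bit1 n) = 2 * numeral n + (1::int)" by (simp add: numeral_Bit1)
  then have "numeral (num.Bit1 n) mod m = (2 * ?r + 1) mod m"
    by (metis mod_add_left_eq mod_mult_right_eq)
  also have "\<dots> = (if 2 * ?r + 1 < m then 2 * ?r + 1 else 2 * ?r + 1 - m)"
  proof (cases "2 * ?r + 1 < m")
    case True
    then show ?thesis using Bit1.prems by simp
  next
    case False
    have "(2 * ?r + 1) mod m = (2 * ?r + 1 - m) mod m" by simp
    also have "\<dots> = 2 * ?r + 1 - m"
      using False Bit1.prems pos_mod_bound[of m "numeral n"] by (intro mod_pos_pos_trivial) linarith+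
    finally show ?thesis using False by simp
  qed
  finally show ?case using Bit1 by (simp add: Let_def)
qed

lemma rem_eq: "m > 1 \<Longrightarrow> x \<ge> 0 \<Longrightarrow> rem m x = x mod m"
  by (cases "x = 0") (simp_all add: rem_def mod_num_eq numeral_to_num)

text \<open>With $m = 2k + 1$, halving either $y$ or $y + m$ preserves divisibility by $m$. Iterated as often as $y$
  has digits, this leads to a number of size at most $m$, which is below $m$ unless $m$ divides $y$.\<close>

fun halve :: "num \<Rightarrow> num \<Rightarrow> num" where
  "halve k num.One = k + num.One"
| "halve k (num.Bit0 y) = y"
| "halve k (num.Bit1 y) = (y + k) + num.One"

fun halves :: "num \<Rightarrow> num \<Rightarrow> num \<Rightarrow> num" where
  "halves k num.One y = y"
| "halves k (num.Bit0 f) y = halves k f (halve k y)"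
| "halves k (num.Bit1 f) y = halves k f (halve k y)"

text \<open>A one-sided test: factors 2 of the modulus are dropped and its odd part is tested, so
  \<open>False\<close> asserts nothing. The first \<open>n\<close> in \<open>halves k n n\<close>
  only supplies the number of halvings.\<close>

fun not_dvd :: "num \<Rightarrow> num \<Rightarrow> bool" where
  "not_dvd num.One n = False"
| "not_dvd (num.Bit0 m) n = not_dvd m n"
| "not_dvd (num.Bit1 k) n = (halves k n n < num.Bit1 k)"

lemma halve_arith:
  fixes a b :: int
  shows "2 * (b + 1) = 1 + (2 * b + 1)" "2 * (a + b + 1) = a + a + 1 + (b + b + 1)"
  by simp_all

lemma halve_dvd:
  assumes "(numeral (num.Bit1 k) :: int) dvd numeral y"
  shows "(numeral (num.Bit1 k) :: int) dvd numeral (halve k y)"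
proof -
  let ?m = "numeral (num.Bit1 k) :: int"
  have m: "?m = 2 * numeral k + 1" by (simp add: numeral_Bit1)
  have "?m dvd 2 * numeral (halve k y)"
  proof (cases y)
    case One
    have "2 * numeral (halve k y) = numeral y + ?m"
      unfolding One m halve.simps numeral_add numeral_One by (rule halve_arith)
    then show ?thesis using assms dvd_add[OF _ dvd_refl] by metis
  next
    case (Bit0 x)
    have "2 * numeral (halve k y) = (numeral y :: int)"
      by (metis Bit0 halve.simps(2) mult_2 numeral_Bit0)
    then show ?thesis using assms by metis
  next
    case (Bit1 x)
    have "2 * numeral (halve k y) = numeral y + ?m"
      unfolding Bit1 m halve.simps numeral_add numeral_Bit1 numeral_One by (rule halve_arith)
    then show ?thesis using assms dvd_add[OF _ dvd_refl] by metis
  qed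
  moreover have "coprime ?m 2" using m by simp
  ultimately show ?thesis using coprime_dvd_mult_right_iff by blast
qed

lemma halves_dvd:
  "(numeral (num.Bit1 k) :: int) dvd numeral y \<Longrightarrow> (numeral (num.Bit1 k) :: int) dvd numeral (halves k f y)"
  by (induction k f y rule: halves.induct) (simp_all only: halves.simps halve_dvd)

lemma not_dvd: "not_dvd m n \<Longrightarrow> \<not> (numeral m :: int) dvd numeral n"
proof (induction m n rule: not_dvd.induct)
  case (2 m n)
  have "(numeral m :: int) dvd numeral (num.Bit0 m)" unfolding numeral_Bit0 by (rule dvd_add) (rule dvd_refl)+
  then show ?case using 2 by (metis dvd_trans not_dvd.simps(2))
next
  case (3 k n)
  show ?case
  proof
    assume "(numeral (num.Bit1 k) :: int) dvd numeral n"
    then have "(numeral (num.Bit1 k) :: int) dvd numeral (halves k n n)" by (rule halves_dvd)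
    then have "(numeral (num.Bit1 k) :: int) \<le> numeral (halves k n n)"
      by (rule zdvd_imp_le) simp
    then have "num.Bit1 k \<le> halves k n n" by (simp only: numeral_le_iff)
    then show False using 3 by simp
  qed
qed simp

section \<open>Primality by trial division\<close>

definition small_primes :: "int list" where
  "small_primes = [2,3,5,7,11,13,17,19,23,29,31,37,41,43,47,53,59,61,67,71,73,79,83,89,97]"

fun no_factor :: "int list \<Rightarrow> int \<Rightarrow> bool" where
  "no_factor [] p = True"
| "no_factor (q # qs) p = (if p = q then True else if rem q p = 0 then False else no_factor qs p)"

text \<open>The bound is 101 * 101: a composite number below it has a prime factor below
  101.\<close>

definition prime_test :: "int \<Rightarrow> bool" where
  "prime_test p \<longleftrightarrow> 1 < p \<and> p < 10201 \<and> no_factor small_primes p"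

text \<open>In the presence of a proper divisor \<open>q\<close> the test can accept only by
  stopping early, at an entry equal to \<open>p\<close> that precedes \<open>q\<close>. For
  \<open>q <= p\<close> this is absurd.\<close>

lemma no_factor:
  assumes "no_factor qs p" "p \<ge> 0" "q \<in> set qs" "\<forall>q\<in>set qs. 1 < q" "sorted_wrt (<) qs" "q dvd p" "q \<noteq> p"
  shows "\<exists>r\<in>set qs. r = p \<and> r < q"
  using assms
proof (induction qs)
  case (Cons a qs)
  show ?case
  proof (cases "p = a")
    case True
    then show ?thesis using Cons.prems by auto
  next
    case False
    have "rem a p = p mod a" using Cons.prems by (intro rem_eq) auto
    then have "p mod a \<noteq> 0" and nf: "no_factor qs p"
      using False Cons.prems(1) by (auto split: if_splits)
    then have "q \<in> set qs" using Cons.prems by auto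
    then have "\<exists>r\<in>set qs. r = p \<and> r < q"
      by (intro Cons.IH[OF nf]) (use Cons.prems in simp_all)
    then show ?thesis by simp
  qed
qed simp

text \<open>A composite number up to 100 has a prime factor at most 10, so striking out proper
  multiples of 2, 3, 5 and 7 shows that \<open>small_primes\<close> is complete up to 100.\<close>

definition sieved :: "int \<Rightarrow> bool" where
  "sieved q \<longleftrightarrow> q \<in> set small_primes \<or> (2 dvd q \<and> q > 2) \<or> (3 dvd q \<and> q > 3) \<or> (5 dvd q \<and> q > 5) \<or> (7 dvd q \<and> q > 7)"

lemma small_prime:
  assumes "prime (q::int)" "q \<le> 100"
  shows "q \<in> set small_primes"
proof -
  have "list_all sieved [2..100]" by code_simp
  moreover have "q \<in> set [2..100]" using assms prime_ge_2_int[of q] by (simp only: set_upto atLeastAtMost_iff)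
  ultimately have "sieved q" unfolding list_all_iff by (rule bspec)
  moreover have no: "\<not> (d dvd q \<and> q > d)" if "d > 1" for d
  proof
    assume d: "d dvd q \<and> q > d"
    have "m = 1 \<or> m = q" if "m \<ge> 0" "m dvd q" for m
      using assms(1)[unfolded prime_int_iff] that by simp
    from this[of d] d \<open>d > 1\<close> show False by simp
  qed
  have "\<not> (2 dvd q \<and> q > 2)" "\<not> (3 dvd q \<and> q > 3)" "\<not> (5 dvd q \<and> q > 5)" "\<not> (7 dvd q \<and> q > 7)"
    by (rule no, simp)+
  ultimately show ?thesis unfolding sieved_def by argo
qed

lemma prime_test: assumes "prime_test p" shows "prime p"
proof (rule ccontr)
  assume "\<not> prime p"
  have p: "1 < p" "p < 10201" "no_factor small_primes p" using assms by (auto simp: prime_test_def)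
  then obtain q where q: "prime q" "q dvd p" using prime_factor_int[of p] by auto
  obtain k where k: "p = q * k" using q by blast
  have "k > 1"
  proof -
    have "q > 1" using q prime_gt_1_int by blast
    moreover have "0 < q * k" using k p by linarith
    ultimately have "k > 0" using zero_less_mult_pos[of q k] by linarith
    moreover have "k \<noteq> 1"
    proof
      assume "k = 1"
      then have "p = q" using k by simp
      then show False using q(1) \<open>\<not> prime p\<close> by blast
    qed
    ultimately show ?thesis by simp
  qed
  have "\<exists>r. prime r \<and> r dvd p \<and> r \<le> 100"
  proof (cases "q \<le> 100")
    case True
    then show ?thesis using q by blast
  next
    case False
    obtain r where r: "prime r" "r dvd k" using \<open>k > 1\<close>
      using prime_factor_int[of k] by auto
    have "k \<le> 100"
    proof (rule ccontr)
      assume "\<not> k \<le> 100"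
      then have "101 * 101 \<le> q * k" using False by (intro mult_mono) auto
      then show False using p(2) k by linarith
    qed
    then have "r \<le> 100" using r(2) \<open>k > 1\<close> zdvd_imp_le[of r k] by linarith
    moreover have "r dvd p" unfolding k using r(2) by (rule dvd_mult)
    ultimately show ?thesis using r(1) by blast
  qed
  then obtain r where r: "prime r" "r dvd p" "r \<le> 100" by blast
  have "r \<noteq> p" using r(1) \<open>\<not> prime p\<close> by blast
  have "\<exists>s\<in>set small_primes. s = p \<and> s < r"
  proof (rule no_factor[OF p(3)])
    show "r \<in> set small_primes" using r by (intro small_prime)
    show "\<forall>q\<in>set small_primes. 1 < q" "sorted_wrt (<) small_primes" by (simp_all add: small_primes_def)
  qed (use p r \<open>r \<noteq> p\<close> in simp_all)
  moreover have "r \<le> p" using r(2) p(1) zdvd_imp_le[of r p] by linarith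
  ultimately show False by auto
qed

section \<open>The arithmetic conditions\<close>

text \<open>The integer counterpart of \<open>gauss1\<close> in Horner form;
  \<open>gauss1_eq\<close> ties the two together.\<close>

fun geo :: "int \<Rightarrow> nat \<Rightarrow> int" where
  "geo b 0 = 0"
| "geo b (Suc n) = b * geo b n + 1"

fun geos :: "int \<Rightarrow> int \<Rightarrow> nat \<Rightarrow> int list" where
  "geos b x 0 = []"
| "geos b x (Suc n) = x # geos b (b * x + 1) n"

fun prodl :: "int list \<Rightarrow> int" where
  "prodl [] = 1"
| "prodl (x # xs) = x * prodl xs"

text \<open>For $C = c_2$ one has $(1 + b)\, c_{u+1} = (1 + b + \dots + b^u)\cdot$ \<open>lin b C u\<close>.\<close>

definition lin :: "int \<Rightarrow> int \<Rightarrow> nat \<Rightarrow> int" where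
  "lin b C u = (1 + b) + (C - 1 - b) * geo b u"

text \<open>Origin: c_{u+1} divides c_{u+2} ... c_{2u+2}. Each of the u + 1 linear factors on the
  right contributes (1 + b) b^u and a Gaussian number after reduction, and one more 1 + b comes from
  clearing the denominator of c_{u+1}.\<close>

definition lin_bound :: "int \<Rightarrow> nat \<Rightarrow> int" where
  "lin_bound b u = (1 + b) ^ (u + 2) * b ^ (u * (u + 1)) * prodl (geos b 1 (2 * u + 2))"

text \<open>This is c_4 c_5 c_6 modulo C - b, up to sign: there C - 1 - b is -1, and the factors
  linear in C become -b^2, -b^2 and -b^2 (1 + b + b^2). It sharpens the case u = 2, since
  \<open>lin b C 2\<close> is (1 + b)(C - b) while \<open>lin_bound b 2\<close> is (1 + b)^7 times
  \<open>bound2 b\<close>.\<close>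

definition bound2 :: "int \<Rightarrow> int" where
  "bound2 b = b ^ 6 * (1 + b + b * b) ^ 2 * (1 + b * b) * geo b 5 * (1 - b + b * b)"

text \<open>The range of \<open>u\<close> ends where 2u + 2 = 14. It starts at 2 because
  \<open>lin b C 1\<close> is \<open>C\<close> itself, whose divisibility generates the
  candidates.\<close>

definition admissible :: "int \<Rightarrow> int \<Rightarrow> bool" where
  "admissible b C \<longleftrightarrow> (C - b) dvd bound2 b \<and> (\<forall>u\<in>{2..6}. lin b C u dvd lin_bound b u)"

lemma geos_eq: "geos b (geo b i) n = map (geo b) [i..<i + n]"
proof (induction n arbitrary: i)
  case (Suc n)
  have "geos b (geo b i) (Suc n) = geo b i # geos b (geo b (Suc i)) n" by simp
  also have "\<dots> = geo b i # map (geo b) [Suc i..<Suc i + n]" by (simp only: Suc.IH)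
  also have "\<dots> = map (geo b) [i..<i + Suc n]" by (simp add: upt_conv_Cons del: upt_Suc)
  finally show ?case .
qed simp

lemma geos_1: "geos b 1 n = map (geo b) [1..<n + 1]"
  using geos_eq[of b 1 n] by simp

lemma prime_dvd_prodl: "prime (m::int) \<Longrightarrow> m dvd prodl xs \<Longrightarrow> \<exists>x\<in>set xs. m dvd x"
proof (induction xs)
  case Nil
  then show ?case by (simp add: not_prime_unit)
next
  case (Cons a xs)
  then show ?case by (auto simp: prime_dvd_mult_iff)
qed

lemma not_dvd_bound:
  assumes "prime m" "\<not> m dvd b" "\<And>k. 1 \<le> k \<Longrightarrow> k \<le> 2 * u + 2 \<Longrightarrow> \<not> m dvd geo b k"
  shows "\<not> m dvd lin_bound b u"
proof
  assume "m dvd lin_bound b u"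
  then consider "m dvd 1 + b" | "m dvd b" | "m dvd prodl (geos b 1 (2 * u + 2))"
    unfolding lin_bound_def using assms(1) by (auto simp: prime_dvd_mult_iff dest: prime_dvd_power)
  then show False
  proof cases
    case 1
    have "geo b 2 = 1 + b" by (simp add: numeral_2_eq_2)
    then show ?thesis using assms(3)[of 2] 1 by simp
  next
    case 3
    then obtain x where "x \<in> set (map (geo b) [1..<2 * u + 2 + 1])" "m dvd x"
      using prime_dvd_prodl assms(1) unfolding geos_1 by blast
    then obtain k where "k \<in> set [1..<2 * u + 2 + 1]" "m dvd geo b k"
      unfolding set_map by blast
    then show ?thesis using assms(3)[of k] by (simp del: upt_Suc)
  qed (use assms in simp)
qed

section \<open>Discrete logarithms\<close>

text \<open>Logarithms are taken in $1, \dots, m - 1$, so that they are values of type \<^typ>\<open>num\<close> and $0$ can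
  stand for a missing logarithm.\<close>

definition is_log :: "int \<times> int \<Rightarrow> int \<Rightarrow> int \<Rightarrow> bool" where
  "is_log I l x \<longleftrightarrow> 0 < l \<and> l \<le> fst I - 1 \<and> [snd I ^ nat l = x] (mod fst I)"

text \<open>By Fermat's theorem exponents of \<open>snd I\<close> then matter only modulo
  \<open>fst I - 1\<close>, which makes the arithmetic of logarithms sound.\<close>

definition base_ok :: "int \<times> int \<Rightarrow> bool" where
  "base_ok I \<longleftrightarrow> prime (fst I) \<and> \<not> fst I dvd snd I \<and> snd I > 0"

lemma base_ok_1: "base_ok I \<Longrightarrow> [snd I ^ nat (fst I - 1) = 1] (mod fst I)"
proof -
  assume I: "base_ok I"
  obtain m g where [simp]: "I = (m, g)" by (cases I)
  define p where "p = nat m"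
  define a where "a = nat g"
  have m: "m = int p" "g = int a" using I prime_gt_0_int[of m] by (auto simp: base_ok_def p_def a_def)
  have "prime p" "\<not> p dvd a" using I m by (auto simp: base_ok_def)
  then have "[a ^ (p - 1) = 1] (mod p)" by (rule fermat_theorem)
  then have "[int (a ^ (p - 1)) = int 1] (mod int p)" by (simp only: cong_int_iff)
  moreover have "nat (m - 1) = p - 1" using m by simp
  ultimately show ?thesis by (simp add: m)
qed

text \<open>Sums and differences of two numbers in 1, ..., n leave this range by at most one period
  \<open>n\<close>, so a single correction suffices.\<close>

definition wrap :: "int \<Rightarrow> int \<Rightarrow> int" where "wrap n x = (if x \<le> n then x else x - n)"
definition unwrap :: "int \<Rightarrow> int \<Rightarrow> int" where "unwrap n x = (if x \<le> 0 then x + n else x)"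

lemma is_log_mult:
  assumes "base_ok I" "is_log I a x" "is_log I c y"
  shows "is_log I (wrap (fst I - 1) (a + c)) (x * y)"
proof -
  obtain m g where [simp]: "I = (m, g)" by (cases I)
  have ac: "0 < a" "a \<le> m - 1" "0 < c" "c \<le> m - 1" "[g ^ nat a = x] (mod m)" "[g ^ nat c = y] (mod m)"
    using assms by (auto simp: is_log_def)
  have xy: "[g ^ nat (a + c) = x * y] (mod m)"
    using cong_mult[OF ac(5,6)] ac by (simp add: nat_add_distrib power_add)
  have one: "[g ^ nat (m - 1) = 1] (mod m)" using base_ok_1[OF assms(1)] by simp
  show ?thesis
  proof (cases "a + c \<le> m - 1")
    case True
    then show ?thesis using ac xy by (simp add: is_log_def wrap_def)
  next
    case False
    define d where "d = a + c - (m - 1)"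
    have d: "0 < d" "d \<le> m - 1" "a + c = d + (m - 1)" using False ac by (auto simp: d_def)
    have "nat (a + c) = nat d + nat (m - 1)" using d(1,3) ac(1,2) by linarith
    then have "g ^ nat (a + c) = g ^ nat d * g ^ nat (m - 1)" by (simp only: power_add)
    moreover have "[g ^ nat d * g ^ nat (m - 1) = g ^ nat d * 1] (mod m)" using one by (rule cong_scalar_left)
    ultimately have "[g ^ nat (a + c) = g ^ nat d] (mod m)" by (simp only: mult_1_right)
    then have "[g ^ nat d = x * y] (mod m)" using xy cong_sym cong_trans by blast
    moreover have "wrap (m - 1) (a + c) = d" using False by (simp add: wrap_def d_def)
    ultimately show ?thesis using d(1,2) by (simp add: is_log_def)
  qed
qed

text \<open>Division without inverses: the power belonging to the difference of logarithms is
  characterised by multiplying back by \<open>B\<close>.\<close>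

lemma is_log_unwrap:
  assumes "base_ok I" "is_log I y A" "is_log I l B"
  shows "0 < unwrap (fst I - 1) (y - l)" "unwrap (fst I - 1) (y - l) \<le> fst I - 1"
    "[snd I ^ nat (unwrap (fst I - 1) (y - l)) * B = A] (mod fst I)"
proof -
  obtain m g where [simp]: "I = (m, g)" by (cases I)
  have ac: "0 < y" "y \<le> m - 1" "0 < l" "l \<le> m - 1" "[g ^ nat y = A] (mod m)" "[g ^ nat l = B] (mod m)"
    using assms by (auto simp: is_log_def)
  have one: "[g ^ nat (m - 1) = 1] (mod m)" using base_ok_1[OF assms(1)] by simp
  define e where "e = unwrap (m - 1) (y - l)"
  have e: "0 < e" "e \<le> m - 1" "e + l = y \<or> e + l = y + (m - 1)" using ac by (auto simp: e_def unwrap_def)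
  then show "0 < unwrap (fst I - 1) (y - l)" "unwrap (fst I - 1) (y - l) \<le> fst I - 1" by (auto simp: e_def)
  have "[g ^ nat (e + l) = A] (mod m)"
  proof (cases "e + l = y")
    case False
    then have "e + l = y + (m - 1)" using e by blast
    then have "g ^ nat (e + l) = g ^ nat y * g ^ nat (m - 1)"
      using ac by (simp add: nat_add_distrib power_add)
    then show ?thesis using cong_mult[OF ac(5) one] by simp
  qed (use ac in simp)
  moreover have "g ^ nat (e + l) = g ^ nat e * g ^ nat l" using e ac by (simp add: nat_add_distrib power_add)
  ultimately have "[g ^ nat e * g ^ nat l = A] (mod m)" by simp
  moreover have "[g ^ nat e * g ^ nat l = g ^ nat e * B] (mod m)" using ac(6) by (rule cong_scalar_left)
  ultimately show "[snd I ^ nat (unwrap (fst I - 1) (y - l)) * B = A] (mod fst I)"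
    unfolding e_def[symmetric] by (simp add: cong_def e_def)
qed

section \<open>Tables of logarithms\<close>

function powers :: "int \<Rightarrow> int \<Rightarrow> int \<Rightarrow> int \<Rightarrow> num trie \<Rightarrow> num trie" where
  "powers m g i x t = (if i \<ge> m then t else powers m g (i + 1) (rem m (g * x)) (ins (to_num x) (to_num i) t))"
  by auto
termination by (relation "measure (\<lambda>(m, g, i, x, t). nat (m - i))") auto

declare powers.simps [simp del]

text \<open>Only the correctness of entries is recorded. A residue without an entry is treated as
  having no logarithm, which can never cause a rejection.\<close>

definition log_table :: "int \<times> int \<Rightarrow> num trie \<Rightarrow> bool" where
  "log_table I t \<longleftrightarrow> (\<forall>k l. look t k = Some l \<longrightarrow> is_log I (numeral l) (numeral k))"

lemma log_table_powers:
  assumes "base_ok (m, g)" "i > 0" "x = g ^ nat i mod m" "log_table (m, g) t"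
  shows "log_table (m, g) (powers m g i x t)"
  using assms
proof (induction m g i x t rule: powers.induct)
  case (1 m g i x t)
  note ok = 1(2) and i = 1(3) and xg = 1(4) and lt = 1(5)
  show ?case
  proof (cases "i \<ge> m")
    case True
    then show ?thesis using lt by (simp add: powers.simps)
  next
    case False
    have m: "prime m" "m > 1" "\<not> m dvd g" "g > 0" using ok prime_gt_1_int by (auto simp: base_ok_def)
    have "x \<noteq> 0" using xg m(1,3) prime_dvd_power[of m g "nat i"] by (auto simp: mod_eq_0_iff_dvd)
    moreover have "x \<ge> 0" using xg m(2) by simp
    ultimately have x: "x > 0" by simp
    have "rem m (g * x) = g ^ nat (i + 1) mod m"
      using i m(2,4) x by (simp add: rem_eq xg nat_add_distrib mod_mult_right_eq)
    moreover
    have lx: "is_log (m, g) i x" using i xg False by (simp add: is_log_def cong_def)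
    have "log_table (m, g) (ins (to_num x) (to_num i) t)"
      unfolding log_table_def look_ins
    proof (intro allI impI)
      fix k l assume a: "(if k = to_num x then Some (to_num i) else look t k) = Some l"
      show "is_log (m, g) (numeral l) (numeral k)"
      proof (cases "k = to_num x")
        case True
        then have "numeral l = i" "numeral k = x" using a x i by (auto simp: numeral_to_num)
        then show ?thesis using lx by simp
      next
        case False
        then show ?thesis using a lt by (simp add: log_table_def)
      qed
    qed
    ultimately have "log_table (m, g) (powers m g (i + 1) (rem m (g * x)) (ins (to_num x) (to_num i) t))"
      using 1(1)[OF False ok] i by simp
    then show ?thesis using False by (subst powers.simps) simp
  qed
qed

fun val :: "num option \<Rightarrow> int" where
  "val None = 0"
| "val (Some l) = numeral l"

text \<open>The guard matters: \<open>to_num 0\<close> is \<open>num.One\<close>, so the residue 0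
  would otherwise receive the logarithm of 1.\<close>

definition dlog1 :: "num trie \<Rightarrow> int \<Rightarrow> int" where
  "dlog1 t r = (if r = 0 then 0 else val (look t (to_num r)))"

fun dlog :: "int \<times> num trie \<Rightarrow> int \<Rightarrow> int" where
  "dlog (m, t) x = dlog1 t (rem m x)"

lemma dlog:
  assumes "base_ok (m, g)" "log_table (m, g) t" "x \<ge> 0" "dlog (m, t) x \<noteq> 0"
  shows "is_log (m, g) (dlog (m, t) x) x"
proof -
  have m: "m > 1" using assms prime_gt_1_int by (auto simp: base_ok_def)
  define r where "r = x mod m"
  have r: "rem m x = r" "r \<ge> 0" using assms m by (auto simp: r_def rem_eq)
  have "r \<noteq> 0" using assms(4) r by (auto simp: dlog1_def)
  moreover have "look t (to_num r) \<noteq> None"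
  proof
    assume "look t (to_num r) = None"
    then show False using assms(4) r by (simp add: dlog1_def split: if_splits)
  qed
  ultimately have "r \<noteq> 0" "look t (to_num r) \<noteq> None" by blast+
  then obtain l where "look t (to_num r) = Some l" by blast
  moreover have "dlog (m, t) x = val (look t (to_num r))" using r \<open>r \<noteq> 0\<close> by (simp add: dlog1_def)
  ultimately have l: "look t (to_num r) = Some l" "dlog (m, t) x = numeral l" by simp_all
  then have "is_log (m, g) (numeral l) (numeral (to_num r))" using assms by (auto simp: log_table_def)
  moreover have "numeral (to_num r) = r" using r \<open>r \<noteq> 0\<close> by (simp add: numeral_to_num)
  ultimately show ?thesis using l by (simp add: is_log_def r_def cong_def)
qed

fun tables :: "(int \<times> int) list \<Rightarrow> (int \<times> num trie) list" where
  "tables [] = []"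
| "tables ((m, g) # xs) = (m, powers m g 1 g Tip) # tables xs"

fun gens_ok :: "(int \<times> int) list \<Rightarrow> bool" where
  "gens_ok [] = True"
| "gens_ok ((m, g) # xs) = (prime_test m \<and> 0 < g \<and> g < m \<and> gens_ok xs)"

definition table_ok :: "int \<times> num trie \<Rightarrow> bool" where
  "table_ok T \<longleftrightarrow> (\<exists>g. base_ok (fst T, g) \<and> log_table (fst T, g) (snd T))"

lemma tables_ok: "gens_ok xs \<Longrightarrow> \<forall>T\<in>set (tables xs). table_ok T"
proof (induction xs rule: tables.induct)
  case (2 m g xs)
  have m: "prime m" "0 < g" "g < m" "gens_ok xs" using 2(2) prime_test by auto
  then have ok: "base_ok (m, g)" by (auto simp: base_ok_def zdvd_not_zless)
  have "log_table (m, g) (powers m g 1 g Tip)"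
    using m ok by (intro log_table_powers) (auto simp: log_table_def)
  then show ?case using 2(1) m ok by (auto simp: table_ok_def)
qed simp

section \<open>Residue classes excluded modulo a small prime\<close>

fun residues :: "int \<Rightarrow> int \<Rightarrow> int \<Rightarrow> nat \<Rightarrow> int list" where
  "residues m b x 0 = []"
| "residues m b x (Suc n) = x # residues m b (rem m (b * x + 1)) n"

lemma residues_eq:
  assumes "m > 1" "b \<ge> 0"
  shows "residues m (b mod m) (geo b i mod m) n = map (\<lambda>k. geo b k mod m) [i..<i + n]"
proof (induction n arbitrary: i)
  case (Suc n)
  have "rem m (b mod m * (geo b i mod m) + 1) = (b mod m * (geo b i mod m) + 1) mod m"
    using assms by (intro rem_eq) auto
  also have "\<dots> = (b * geo b i + 1) mod m" by (metis mod_add_left_eq mod_mult_eq)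
  also have "\<dots> = geo b (Suc i) mod m" by simp
  finally have *: "rem m (b mod m * (geo b i mod m) + 1) = geo b (Suc i) mod m" .
  have "residues m (b mod m) (geo b i mod m) (Suc n) = geo b i mod m # residues m (b mod m) (geo b (Suc i) mod m) n"
    by (simp only: residues.simps *)
  also have "\<dots> = geo b i mod m # map (\<lambda>k. geo b k mod m) [Suc i..<Suc i + n]" by (simp only: Suc.IH)
  also have "\<dots> = map (\<lambda>k. geo b k mod m) [i..<i + Suc n]" by (simp add: upt_conv_Cons del: upt_Suc geo.simps)
  finally show ?case .
qed simp

definition quotient_log :: "int \<Rightarrow> int \<Rightarrow> int \<Rightarrow> int" where
  "quotient_log n x y = (if x = 0 then 0 else if y = 0 then 0 else unwrap n (x - y))"

text \<open>At index \<open>u\<close> the first list starts with \<open>geo b (u - 1)\<close>,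
  \<open>geo b u\<close> and the second with \<open>geo b (2 * u + 1)\<close>,
  \<open>geo b (2 * u + 2)\<close>, all modulo \<open>m\<close>; hence the steps by one and by two.
  A zero in the second list ends the search, because \<open>m\<close> then divides
  \<open>lin_bound b u\<close> and all later bounds.\<close>

fun bad_logs :: "int \<times> num trie \<Rightarrow> int \<Rightarrow> int list \<Rightarrow> int list \<Rightarrow> int list" where
  "bad_logs (m, t) q (x # y # xs) (v # w # ys) = (if v = 0 \<or> w = 0 then [] else
     quotient_log (m - 1) (dlog (m, t) (q * x)) (dlog (m, t) y) # bad_logs (m, t) q (y # xs) ys)"
| "bad_logs T q _ _ = []"

fun bad_logs0 :: "int \<times> num trie \<Rightarrow> int \<Rightarrow> int list \<Rightarrow> int list" where
  "bad_logs0 T q (a # b # c # d # xs) = (if b = 0 \<or> c = 0 \<or> d = 0 then [] else bad_logs T q (a # b # c # d # xs) xs)"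
| "bad_logs0 T q _ = []"

text \<open>The relevant \<open>y\<close> is the logarithm of the solution $C$ of \<open>lin b C u\<close> $\equiv 0$, namely of
  $(1 + b)\, b\, (1 + \dots + b^{u-2}) / (1 + \dots + b^{u-1})$, for some $u$ with $m$ not dividing
  \<open>lin_bound b u\<close>.\<close>

definition excluded :: "int \<Rightarrow> int \<times> int \<Rightarrow> int \<Rightarrow> bool" where
  "excluded b I y \<longleftrightarrow> 0 < y \<and> y \<le> fst I - 1 \<and> (\<forall>C. [snd I ^ nat y = C] (mod fst I) \<longrightarrow> \<not> admissible b C)"

lemma excluded:
  assumes I: "base_ok (m, g)" "log_table (m, g) t" and b: "b > 0" "\<not> m dvd b"
    and u: "2 \<le> u" "u \<le> 6" and nz: "\<And>k. 1 \<le> k \<Longrightarrow> k \<le> 2 * u + 2 \<Longrightarrow> \<not> m dvd geo b k"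
    and q: "q \<ge> 0" "[q = (1 + b) * b] (mod m)"
    and y: "y = quotient_log (m - 1) (dlog (m, t) (q * (geo b (u - 1) mod m))) (dlog (m, t) (geo b u mod m))"
    and "y \<noteq> 0"
  shows "excluded b (m, g) y"
proof -
  have m: "m > 1" "prime m" using I prime_gt_1_int by (auto simp: base_ok_def)
  let ?x = "dlog (m, t) (q * (geo b (u - 1) mod m))" and ?z = "dlog (m, t) (geo b u mod m)"
  have nz0: "?x \<noteq> 0" "?z \<noteq> 0" "y = unwrap (m - 1) (?x - ?z)"
    using y \<open>y \<noteq> 0\<close> by (auto simp: quotient_log_def split: if_splits)
  have lx: "is_log (m, g) ?x (q * (geo b (u - 1) mod m))"
    using I nz0 q m by (intro dlog) auto
  have lz: "is_log (m, g) ?z (geo b u mod m)"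
    using I nz0 m by (intro dlog) auto
  have un: "0 < y" "y \<le> m - 1" "[g ^ nat y * (geo b u mod m) = q * (geo b (u - 1) mod m)] (mod m)"
    using is_log_unwrap[OF I(1) lx lz] unfolding nz0(3)[symmetric] fst_conv snd_conv by blast+
  have "\<not> admissible b C" if C: "[g ^ nat y = C] (mod m)" for C
  proof
    assume "admissible b C"
    then have L: "lin b C u dvd lin_bound b u" using u by (auto simp: admissible_def)
    obtain v where v: "u = Suc v" using u by (cases u) auto
    have "[C * geo b u = g ^ nat y * (geo b u mod m)] (mod m)"
      using cong_sym[OF C] by (rule cong_mult) (simp only: cong_def mod_mod_trivial)
    also have "[g ^ nat y * (geo b u mod m) = q * (geo b (u - 1) mod m)] (mod m)" by (rule un)
    also have "[q * (geo b (u - 1) mod m) = (1 + b) * b * geo b (u - 1)] (mod m)"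
      using q(2) by (rule cong_mult) (simp only: cong_def mod_mod_trivial)
    finally have "m dvd C * geo b u - (1 + b) * b * geo b v"
      unfolding v diff_Suc_1 by (simp only: cong_iff_dvd_diff)
    \<comment> \<open>Since \<open>geo b u = b * geo b (u - 1) + 1\<close>, the congruence defining
      \<open>y\<close> says that \<open>m\<close> divides \<open>lin b C u\<close>.\<close>
    also have "C * geo b u - (1 + b) * b * geo b v = lin b C u"
      by (simp add: lin_def v algebra_simps)
    finally have "m dvd lin_bound b u" using L dvd_trans by blast
    then show False using not_dvd_bound[OF m(2) b(2) nz] by blast
  qed
  then show ?thesis using un by (simp add: excluded_def)
qed

text \<open>The 14 available Gaussian numbers run out at \<open>u = 7\<close>, where the induction
  on \<open>7 - u\<close> starts. Each step extends the nonvanishing hypothesis by the two entries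
  just checked.\<close>

lemma bad_logs:
  assumes I: "base_ok (m, g)" "log_table (m, g) t" and b: "b > 0" "\<not> m dvd b"
    and q: "q \<ge> 0" "[q = (1 + b) * b] (mod m)"
  shows "\<lbrakk>2 \<le> u; u \<le> 7; xs = map (\<lambda>k. geo b k mod m) [u - 1..<15]; ys = map (\<lambda>k. geo b k mod m) [2 * u + 1..<15];
    \<And>k. 1 \<le> k \<Longrightarrow> k \<le> 2 * u \<Longrightarrow> \<not> m dvd geo b k; y \<in> set (bad_logs (m, t) q xs ys); y \<noteq> 0\<rbrakk> \<Longrightarrow> excluded b (m, g) y"
proof (induction "7 - u" arbitrary: u xs ys)
  case 0
  then have "u = 7" by simp
  then have "ys = []" using 0 by simp
  then show ?case using 0 by simp
next
  case (Suc n)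
  note u = Suc(3,4) and nz = Suc(7)
  have u6: "u \<le> 6" using Suc(2) by simp
  let ?G = "\<lambda>k. geo b k mod m"
  have e: "[u - 1..<15] = (u - 1) # u # [Suc u..<15]" "[u..<15] = u # [Suc u..<15]"
    "[2 * u + 1..<15] = (2 * u + 1) # (2 * u + 2) # [2 * Suc u + 1..<15]"
    using u u6 by (simp_all add: upt_conv_Cons)
  have cl: "bad_logs (m, t) q xs ys = (if ?G (2 * u + 1) = 0 \<or> ?G (2 * u + 2) = 0 then [] else
     quotient_log (m - 1) (dlog (m, t) (q * ?G (u - 1))) (dlog (m, t) (?G u))
       # bad_logs (m, t) q (map ?G [Suc u - 1..<15]) (map ?G [2 * Suc u + 1..<15]))"
    unfolding Suc(5,6) e by (simp only: list.map bad_logs.simps e(2) diff_Suc_1)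
  have nz2: "?G (2 * u + 1) \<noteq> 0" "?G (2 * u + 2) \<noteq> 0" using Suc(8) unfolding cl by (auto split: if_splits)
  have nz': "\<not> m dvd geo b k" if "1 \<le> k" "k \<le> 2 * u + 2" for k
  proof -
    have "k \<le> 2 * u \<or> k = 2 * u + 1 \<or> k = 2 * u + 2" using that by linarith
    then consider "k \<le> 2 * u" | "k = 2 * u + 1" | "k = 2 * u + 2" by blast
    then show ?thesis
    proof cases
      case 1
      then show ?thesis using nz that by blast
    next
      case 2
      then show ?thesis using nz2(1) dvd_imp_mod_0 by blast
    next
      case 3
      then show ?thesis using nz2(2) dvd_imp_mod_0 by blast
    qed
  qed
  have "y = quotient_log (m - 1) (dlog (m, t) (q * ?G (u - 1))) (dlog (m, t) (?G u)) \<or>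
    y \<in> set (bad_logs (m, t) q (map ?G [Suc u - 1..<15]) (map ?G [2 * Suc u + 1..<15]))"
    using Suc(8) nz2 unfolding cl by (simp only: if_False disj_not1 simp_thms list.set insert_iff)
  then show ?case
  proof
    assume "y = quotient_log (m - 1) (dlog (m, t) (q * ?G (u - 1))) (dlog (m, t) (?G u))"
    then show ?thesis by (intro excluded[OF I b u(1) u6 nz' q _ Suc(9)])
  next
    assume "y \<in> set (bad_logs (m, t) q (map ?G [Suc u - 1..<15]) (map ?G [2 * Suc u + 1..<15]))"
    then show ?thesis by (intro Suc(1)[of "Suc u", OF _ _ _ refl refl _ _ Suc(9)]) (use Suc(2) u u6 nz' in auto)
  qed
qed

fun dlogs :: "int \<times> num trie \<Rightarrow> int list \<Rightarrow> int list" where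
  "dlogs T [] = []"
| "dlogs T (p # ps) = dlog T p # dlogs T ps"

text \<open>Here \<open>b\<close> is already reduced modulo \<open>m\<close>. If it is 0, all
  Gaussian numbers are 1 and would pass the zero tests although \<open>m\<close> divides every
  bound; hence the separate case.\<close>

fun prepare1 :: "int \<times> num trie \<Rightarrow> int \<Rightarrow> int list \<Rightarrow> int \<times> int list \<times> int list" where
  "prepare1 (m, t) b ps = (m - 1,
     (if b = 0 then [] else bad_logs0 (m, t) (rem m ((1 + b) * b)) (residues m b 1 14)), dlogs (m, t) ps)"

fun prepare :: "int \<Rightarrow> int list \<Rightarrow> (int \<times> num trie) list \<Rightarrow> (int \<times> int list \<times> int list) list" where
  "prepare b ps [] = []"
| "prepare b ps ((m, t) # Ts) = prepare1 (m, t) (rem m b) ps # prepare b ps Ts"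

fun nonzero :: "int list \<Rightarrow> bool" where
  "nonzero [] = True"
| "nonzero (x # xs) = (if x = 0 then False else nonzero xs)"

text \<open>A modulus is kept only if it excludes something and all logarithms exist. In particular
  a modulus that is itself a prime factor of the candidates drops out.\<close>

fun useful :: "(int \<times> int list \<times> int list) list \<Rightarrow> (int \<times> int list \<times> int list) list" where
  "useful [] = []"
| "useful ((n, ys, ls) # xs) =
     (if ys = [] \<or> \<not> nonzero ys \<or> \<not> nonzero ls then useful xs else (n, ys, ls) # useful xs)"

definition datum :: "int \<Rightarrow> int list \<Rightarrow> int \<times> int \<Rightarrow> int \<times> int list \<times> int list \<Rightarrow> bool" where
  "datum b ps I X \<longleftrightarrow> base_ok I \<and> fst X = fst I - 1 \<and> (\<forall>y\<in>set (fst (snd X)). excluded b I y) \<and>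
     list_all2 (is_log I) (snd (snd X)) ps"

lemma dlogs: "base_ok (m, g) \<Longrightarrow> log_table (m, g) t \<Longrightarrow> \<forall>p\<in>set ps. p \<ge> 0 \<Longrightarrow> nonzero (dlogs (m, t) ps) \<Longrightarrow>
    list_all2 (is_log (m, g)) (dlogs (m, t) ps) ps"
proof (induction ps)
  case (Cons p ps)
  then show ?case using dlog[OF Cons(2,3), of p] by (auto split: if_splits)
qed simp

lemma nonzero: "nonzero xs \<Longrightarrow> x \<in> set xs \<Longrightarrow> x \<noteq> 0"
  by (induction xs) (auto split: if_splits)

lemma bad_logs0:
  assumes "y \<in> set (bad_logs0 T q xs)"
  obtains a b c d ys where "xs = a # b # c # d # ys" "b \<noteq> 0" "c \<noteq> 0" "d \<noteq> 0" "y \<in> set (bad_logs T q xs ys)"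
proof (cases "(T, q, xs)" rule: bad_logs0.cases)
  case (1 T' q' a b c d ys)
  then have "b \<noteq> 0 \<and> c \<noteq> 0 \<and> d \<noteq> 0 \<and> y \<in> set (bad_logs T q xs ys)"
    using assms by (simp del: bad_logs.simps split: if_splits)
  then show ?thesis using that[of a b c d ys] 1 by simp
qed (use assms in simp_all)

lemma upt_1_15: "[1..<15] = 1 # 2 # 3 # 4 # [5..<15::nat]"
  by code_simp

lemma prepare1:
  assumes I: "base_ok (m, g)" "log_table (m, g) t" and b: "b > 0" and ps: "\<forall>p\<in>set ps. p \<ge> 0"
    and X: "prepare1 (m, t) (rem m b) ps = (n, ys, ls)" "nonzero ys" "nonzero ls"
  shows "datum b ps (m, g) (n, ys, ls)"
proof -
  have m: "m > 1" using I prime_gt_1_int by (auto simp: base_ok_def)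
  let ?G = "\<lambda>k. geo b k mod m"
  have bm: "rem m b = b mod m" using b m by (simp add: rem_eq)
  have "excluded b (m, g) y" if y: "y \<in> set ys" for y
  proof -
    have "rem m b \<noteq> 0" using X y by auto
    then have nb: "\<not> m dvd b" using bm dvd_imp_mod_0[of m b] by auto
    define q where "q = rem m ((1 + rem m b) * rem m b)"
    have "q = (1 + b mod m) * (b mod m) mod m" unfolding q_def bm using m by (intro rem_eq) auto
    moreover have "[(1 + b mod m) * (b mod m) = (1 + b) * b] (mod m)"
      by (intro cong_mult cong_add cong_refl) (simp_all add: cong_def)
    ultimately have q: "q \<ge> 0" "[q = (1 + b) * b] (mod m)" using m by (simp_all add: cong_def)
    have "residues m (b mod m) (geo b 1 mod m) 14 = map ?G [1..<1 + 14]"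
      by (rule residues_eq) (use b m in auto)
    moreover have "geo b 1 mod m = 1" using m by simp
    ultimately have R: "residues m (rem m b) 1 14 = map ?G [1..<15]" unfolding bm by (simp del: upt_Suc)
    have "ys = bad_logs0 (m, t) q (map ?G [1..<15])"
      using X(1) \<open>rem m b \<noteq> 0\<close> unfolding prepare1.simps R q_def[symmetric]
      by (simp only: if_False prod.inject)
    then have "y \<in> set (bad_logs0 (m, t) q (map ?G [1..<15]))" using y by (simp only:)
    from bad_logs0[OF this] obtain a1 a2 a3 a4 zs where zs: "map ?G [1..<15] = a1 # a2 # a3 # a4 # zs"
      "a2 \<noteq> 0" "a3 \<noteq> 0" "a4 \<noteq> 0" "y \<in> set (bad_logs (m, t) q (map ?G [1..<15]) zs)" .
    have eqs: "a2 = ?G 2" "a3 = ?G 3" "a4 = ?G 4" "zs = map ?G [5..<15]"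
      using zs(1) unfolding upt_1_15 list.map by (simp_all only: list.inject)
    have ys: "?G 2 \<noteq> 0" "?G 3 \<noteq> 0" "?G 4 \<noteq> 0" using zs(2-4) unfolding eqs .
    have y2: "y \<in> set (bad_logs (m, t) q (map ?G [1..<15]) (map ?G [5..<15]))" using zs(5) unfolding eqs .
    have nz: "\<not> m dvd geo b k" if "1 \<le> k" "k \<le> 2 * 2" for k
    proof -
      have "k = 1 \<or> k = 2 \<or> k = 3 \<or> k = 4" using that by linarith
      then consider "k = 1" | "k = 2" | "k = 3" | "k = 4" by blast
      then show ?thesis
      proof cases
        case 1
        then show ?thesis using m by (simp add: zdvd_not_zless)
      next
        case 2 then show ?thesis using ys(1) by (simp only: mod_eq_0_iff_dvd simp_thms)
      next
        case 3 then show ?thesis using ys(2) by (simp only: mod_eq_0_iff_dvd simp_thms)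
      next
        case 4 then show ?thesis using ys(3) by (simp only: mod_eq_0_iff_dvd simp_thms)
      qed
    qed
    have "map ?G [1..<15] = map ?G [2 - 1..<15]" "map ?G [5..<15] = map ?G [2 * 2 + 1..<15]" by simp_all
    from bad_logs[OF I b nb q order_refl _ this nz y2 nonzero[OF X(2) y]] show ?thesis by simp
  qed
  moreover have "ls = dlogs (m, t) ps" "n = m - 1" using X(1) by (simp_all del: bad_logs0.simps residues.simps)
  moreover have "list_all2 (is_log (m, g)) ls ps"
    unfolding calculation(2) by (rule dlogs[OF I ps]) (use X(3) calculation(2) in \<open>simp only:\<close>)
  ultimately show ?thesis using I unfolding datum_def fst_conv snd_conv by (intro conjI ballI)
qed

lemma useful_prepare:
  assumes "\<forall>T\<in>set Ts. table_ok T" "b > 0" "\<forall>p\<in>set ps. p \<ge> 0"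
  shows "\<exists>Is. list_all2 (datum b ps) Is (useful (prepare b ps Ts))"
  using assms(1)
proof (induction Ts)
  case (Cons T Ts)
  obtain m t where T: "T = (m, t)" by (cases T)
  have "\<forall>T\<in>set Ts. table_ok T" using Cons(2) by simp
  then obtain Is where Is: "list_all2 (datum b ps) Is (useful (prepare b ps Ts))" using Cons(1) by blast
  obtain g where I: "base_ok (m, g)" "log_table (m, g) t" using Cons(2) T by (auto simp: table_ok_def)
  obtain n ys ls where X: "prepare1 (m, t) (rem m b) ps = (n, ys, ls)"
    by (cases "prepare1 (m, t) (rem m b) ps" rule: prod_cases3)
  have p: "prepare b ps (T # Ts) = (n, ys, ls) # prepare b ps Ts" by (simp only: T prepare.simps X)
  show ?case
  proof (cases "ys = [] \<or> \<not> nonzero ys \<or> \<not> nonzero ls")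
    case True
    then have eq: "useful (prepare b ps (T # Ts)) = useful (prepare b ps Ts)" unfolding p useful.simps by (rule if_P)
    show ?thesis by (rule exI[of _ Is]) (simp only: eq Is)
  next
    case False
    then have "datum b ps (m, g) (n, ys, ls)" using prepare1[OF I assms(2,3) X] by blast
    then have "list_all2 (datum b ps) ((m, g) # Is) (useful (prepare b ps (T # Ts)))"
      using False Is by (simp only: p useful.simps if_False list_all2_Cons simp_thms)
    then show ?thesis by (rule exI)
  qed
next
  case Nil
  show ?case by (rule exI[of _ "[]"]) simp
qed

section \<open>The sieve\<close>

text \<open>A leaf holds a divisor with its logarithms, one per kept modulus. Nodes are plain
  unions, so collecting divisors needs no concatenation.\<close>

datatype tree = Leaf int "int list" | Node tree tree

fun leaves :: "tree \<Rightarrow> (int \<times> int list) set" where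
  "leaves (Leaf v L) = {(v, L)}"
| "leaves (Node l r) = leaves l \<union> leaves r"

fun add_logs :: "int list \<Rightarrow> int list \<Rightarrow> int list \<Rightarrow> int list" where
  "add_logs (n # ns) (a # as) (c # cs) = wrap n (a + c) # add_logs ns as cs"
| "add_logs _ _ _ = []"

fun scale :: "int list \<Rightarrow> int \<Rightarrow> int list \<Rightarrow> tree \<Rightarrow> tree" where
  "scale ns v L (Leaf w K) = Leaf (v * w) (add_logs ns L K)"
| "scale ns v L (Node l r) = Node (scale ns v L l) (scale ns v L r)"

fun powers_times :: "int list \<Rightarrow> int \<Rightarrow> int list \<Rightarrow> nat \<Rightarrow> tree \<Rightarrow> tree" where
  "powers_times ns p L 0 t = t"
| "powers_times ns p L (Suc e) t = Node t (powers_times ns p L e (scale ns p L t))"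

fun heads :: "int list list \<Rightarrow> int list" where
  "heads [] = []"
| "heads ((x # xs) # M) = x # heads M"
| "heads ([] # M) = []"

fun tails :: "int list list \<Rightarrow> int list list" where
  "tails [] = []"
| "tails ((x # xs) # M) = xs # tails M"
| "tails ([] # M) = []"

text \<open>The rows of \<open>M\<close> belong to the moduli and its columns to the primes, so
  \<open>heads M\<close> lists the logarithms of the current prime.\<close>

fun divisors :: "int list \<Rightarrow> (int \<times> nat) list \<Rightarrow> int list list \<Rightarrow> tree \<Rightarrow> tree" where
  "divisors ns [] M t = t"
| "divisors ns ((p, e) # P) M t = divisors ns P (tails M) (powers_times ns p (heads M) e t)"

text \<open>Moves past the columns used for the first factor, to those of the second.\<close>

fun skip :: "'a list \<Rightarrow> int list list \<Rightarrow> int list list" where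
  "skip [] M = M"
| "skip (x # xs) M = skip xs (tails M)"

fun pp_prod :: "(int \<times> nat) list \<Rightarrow> int" where
  "pp_prod [] = 1"
| "pp_prod ((p, e) # P) = p ^ e * pp_prod P"

fun primes_ok :: "(int \<times> nat) list \<Rightarrow> bool" where
  "primes_ok [] = True"
| "primes_ok ((p, e) # P) = (prime_test p \<and> primes_ok P)"

fun firsts :: "(int \<times> 'b) list \<Rightarrow> int list" where
  "firsts [] = []"
| "firsts ((x, y) # xs) = x # firsts xs"

fun seconds :: "(int \<times> 'b \<times> 'c) list \<Rightarrow> 'b list" where
  "seconds [] = []"
| "seconds ((x, y, z) # xs) = y # seconds xs"

fun thirds :: "(int \<times> 'b \<times> 'c) list \<Rightarrow> 'c list" where
  "thirds [] = []"
| "thirds ((x, y, z) # xs) = z # thirds xs"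

definition has_logs :: "(int \<times> int) list \<Rightarrow> int \<Rightarrow> int list \<Rightarrow> bool" where
  "has_logs Is v L \<longleftrightarrow> list_all2 (\<lambda>I l. is_log I l v) Is L"

definition tree_ok :: "(int \<times> int) list \<Rightarrow> tree \<Rightarrow> bool" where
  "tree_ok Is t \<longleftrightarrow> (\<forall>(v, L)\<in>leaves t. has_logs Is v L)"

lemma has_logs_add:
  assumes "\<forall>I\<in>set Is. base_ok I" "has_logs Is v L" "has_logs Is w K"
  shows "has_logs Is (v * w) (add_logs (map (\<lambda>I. fst I - 1) Is) L K)"
  using assms
proof (induction Is arbitrary: L K)
  case (Cons I Is)
  obtain a L' where L: "L = a # L'" "is_log I a v" "has_logs Is v L'"
    using Cons(3) by (auto simp: has_logs_def list_all2_Cons1)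
  obtain c K' where K: "K = c # K'" "is_log I c w" "has_logs Is w K'"
    using Cons(4) by (auto simp: has_logs_def list_all2_Cons1)
  have "is_log I (wrap (fst I - 1) (a + c)) (v * w)" using is_log_mult[OF _ L(2) K(2)] Cons(2) by simp
  then show ?case using Cons(1)[OF _ L(3) K(3)] Cons(2) by (simp add: L K has_logs_def)
qed (simp add: has_logs_def)

lemma leaves_scale: "leaves (scale ns v L t) = (\<lambda>(w, K). (v * w, add_logs ns L K)) ` leaves t"
  by (induction t) auto

lemma tree_ok_scale:
  assumes "\<forall>I\<in>set Is. base_ok I" "has_logs Is v L" "tree_ok Is t"
  shows "tree_ok Is (scale (map (\<lambda>I. fst I - 1) Is) v L t)"
  using assms has_logs_add[OF assms(1,2)] by (auto simp: tree_ok_def leaves_scale)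

lemma tree_ok_powers_times:
  assumes "\<forall>I\<in>set Is. base_ok I" "has_logs Is v L" "tree_ok Is t"
  shows "tree_ok Is (powers_times (map (\<lambda>I. fst I - 1) Is) v L e t)"
  using assms(3)
proof (induction e arbitrary: t)
  case (Suc e)
  then show ?case using Suc(1)[OF tree_ok_scale[OF assms(1,2) Suc(2)]] by (auto simp: tree_ok_def)
qed simp

lemma values_powers_times:
  "k \<le> e \<Longrightarrow> v \<in> fst ` leaves t \<Longrightarrow> p ^ k * v \<in> fst ` leaves (powers_times ns p L e t)"
proof (induction e arbitrary: k t v)
  case (Suc e)
  show ?case
  proof (cases k)
    case 0
    then show ?thesis using Suc by auto
  next
    case (Suc k')
    have "p * v \<in> fst ` leaves (scale ns p L t)" using Suc.prems(2) by (force simp: leaves_scale)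
    then have *: "p ^ k' * (p * v) \<in> fst ` leaves (powers_times ns p L e (scale ns p L t))"
      using Suc Suc.prems(1) by (intro Suc.IH) auto
    have eq: "p ^ k * v = p ^ k' * (p * v)" using Suc by simp
    show ?thesis using * unfolding eq powers_times.simps leaves.simps image_Un by (rule UnI2)
  qed
qed auto

definition cols_ok :: "(int \<times> int) list \<Rightarrow> int list list \<Rightarrow> int list \<Rightarrow> bool" where
  "cols_ok Is M ps \<longleftrightarrow> list_all2 (\<lambda>I ls. list_all2 (is_log I) ls ps) Is M"

lemma cols_ok_Cons:
  assumes "cols_ok Is M (p # ps)"
  shows "has_logs Is p (heads M)" "cols_ok Is (tails M) ps"
proof -
  have "has_logs Is p (heads M) \<and> cols_ok Is (tails M) ps"
    using assms
  proof (induction Is arbitrary: M)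
    case (Cons I Is)
    then obtain ls M' where M: "M = ls # M'" "list_all2 (is_log I) ls (p # ps)" "cols_ok Is M' (p # ps)"
      by (auto simp: cols_ok_def list_all2_Cons1)
    then obtain l ls' where "ls = l # ls'" "is_log I l p" "list_all2 (is_log I) ls' ps"
      by (auto simp: list_all2_Cons2)
    then show ?case using Cons(1)[OF M(3)] M by (auto simp: cols_ok_def has_logs_def)
  qed (simp add: cols_ok_def has_logs_def)
  then show "has_logs Is p (heads M)" "cols_ok Is (tails M) ps" by blast+
qed

lemma tree_ok_divisors:
  assumes "\<forall>I\<in>set Is. base_ok I"
  shows "cols_ok Is M (firsts P @ ps) \<Longrightarrow> tree_ok Is t \<Longrightarrow>
    tree_ok Is (divisors (map (\<lambda>I. fst I - 1) Is) P M t) \<and> cols_ok Is (skip P M) ps"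
proof (induction P arbitrary: M t)
  case (Cons x P)
  obtain p e where x: "x = (p, e)" by (cases x)
  have c: "cols_ok Is M (p # firsts P @ ps)" using Cons(2) x by simp
  show ?case using Cons(1)[OF cols_ok_Cons(2)[OF c] tree_ok_powers_times[OF assms cols_ok_Cons(1)[OF c] Cons(3)]]
    by (simp add: x)
qed simp

text \<open>A divisor of a product splits into divisors of the factors, and a divisor of
  \<open>p ^ e\<close> is a power of \<open>p\<close> up to sign; absolute values dispose of the
  signs. The value \<open>v\<close> accumulates the prime powers already chosen.\<close>

lemma values_divisors:
  assumes "primes_ok P" "d > 0" "d dvd pp_prod P" "v \<in> fst ` leaves t"
  shows "d * v \<in> fst ` leaves (divisors ns P M t)"
  using assms
proof (induction P arbitrary: d v t M)
  case Nil
  then have "d = 1" by simp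
  then show ?case using Nil by simp
next
  case (Cons x P)
  obtain p e where x: "x = (p, e)" by (cases x)
  have p: "prime p" "primes_ok P" using Cons(2) prime_test by (auto simp: x)
  have "d dvd p ^ e * pp_prod P" using Cons(4) by (simp add: x)
  from division_decomp[OF this] obtain a c where ac: "d = a * c" "a dvd p ^ e" "c dvd pp_prod P"
    by (elim exE conjE)
  from divides_primepow[OF p(1) ac(2)] obtain k where k: "k \<le> e" "normalize a = p ^ k" .
  have k2: "\<bar>a\<bar> = p ^ k" using k(2) by simp
  have "\<bar>d\<bar> = \<bar>a\<bar> * \<bar>c\<bar>" unfolding ac(1) by (rule abs_mult)
  then have "d = \<bar>a\<bar> * \<bar>c\<bar>" using Cons(3) by (simp only: abs_of_pos)
  then have d: "d = p ^ k * \<bar>c\<bar>" by (simp only: k2)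
  have "c \<noteq> 0" using Cons(3) d by (cases "c = 0") simp_all
  then have "\<bar>c\<bar> > 0" by simp
  moreover have "\<bar>c\<bar> dvd pp_prod P" using ac(3) by simp
  moreover have "p ^ k * v \<in> fst ` leaves (powers_times ns p (heads M) e t)"
    using k(1) Cons(5) by (rule values_powers_times)
  ultimately have "\<bar>c\<bar> * (p ^ k * v) \<in> fst ` leaves (divisors ns P (tails M) (powers_times ns p (heads M) e t))"
    using Cons(1)[OF p(2)] by blast
  moreover have "\<bar>c\<bar> * (p ^ k * v) = d * v" unfolding d by (simp only: ac_simps)
  ultimately show ?case by (simp only: x divisors.simps)
qed

text \<open>Logarithms are compared in blocks of four moduli at a time, so that the tree shrinks after each block.\<close>

datatype ctree = CTip | CLeaf int "num list list" | CNode ctree ctree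

fun chunks :: "'a list \<Rightarrow> 'a list list" where
  "chunks (a # b # c # d # xs) = [a, b, c, d] # chunks xs"
| "chunks xs = [xs]"

fun to_nums :: "int list \<Rightarrow> num list" where
  "to_nums [] = []"
| "to_nums (x # xs) = to_num x # to_nums xs"

fun chunk_tree :: "tree \<Rightarrow> ctree" where
  "chunk_tree (Leaf v L) = CLeaf v (chunks (to_nums L))"
| "chunk_tree (Node l r) = CNode (chunk_tree l) (chunk_tree r)"

fun cleaves :: "ctree \<Rightarrow> (int \<times> num list list) set" where
  "cleaves CTip = {}"
| "cleaves (CLeaf v L) = {(v, L)}"
| "cleaves (CNode l r) = cleaves l \<union> cleaves r"

text \<open>Divisors $C = vw$ are searched as pairs: the logarithms of $w$ are subtracted from the excluded ones once,
  and those of all $v$ are then looked up.\<close>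

fun insert_logs :: "int \<Rightarrow> int \<Rightarrow> int list \<Rightarrow> unit trie \<Rightarrow> unit trie" where
  "insert_logs n l [] t = t"
| "insert_logs n l (y # ys) t = insert_logs n l ys (ins (to_num (unwrap n (y - l))) () t)"

fun tries :: "int list \<Rightarrow> int list list \<Rightarrow> int list \<Rightarrow> unit trie list" where
  "tries (n # ns) (ys # yss) (l # ls) = insert_logs n l ys Tip # tries ns yss ls"
| "tries _ _ _ = []"

text \<open>The result of a lookup is passed to \<open>hit1\<close>, so that the remaining moduli
  are consulted only after a miss.\<close>

fun hit :: "num list \<Rightarrow> unit trie list \<Rightarrow> bool" and hit1 :: "unit option \<Rightarrow> num list \<Rightarrow> unit trie list \<Rightarrow> bool" where
  "hit [] ts = False"
| "hit (a # as) [] = False"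
| "hit (a # as) (t # ts) = hit1 (look t a) as ts"
| "hit1 None as ts = hit as ts"
| "hit1 (Some u) as ts = True"

text \<open>Empty subtrees vanish here, so that later blocks traverse only the survivors.\<close>

fun join :: "ctree \<Rightarrow> ctree \<Rightarrow> ctree" where
  "join CTip r = r"
| "join (CLeaf v L) CTip = CLeaf v L"
| "join (CLeaf v L) (CLeaf w K) = CNode (CLeaf v L) (CLeaf w K)"
| "join (CLeaf v L) (CNode l r) = CNode (CLeaf v L) (CNode l r)"
| "join (CNode l r) CTip = CNode l r"
| "join (CNode l r) (CLeaf w K) = CNode (CNode l r) (CLeaf w K)"
| "join (CNode l r) (CNode l' r') = CNode (CNode l r) (CNode l' r')"

fun sift1 :: "bool \<Rightarrow> int \<Rightarrow> num list list \<Rightarrow> ctree" where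
  "sift1 True v L = CTip"
| "sift1 False v L = CLeaf v L"

fun sift :: "unit trie list \<Rightarrow> ctree \<Rightarrow> ctree" where
  "sift ts CTip = CTip"
| "sift ts (CLeaf v []) = CLeaf v []"
| "sift ts (CLeaf v (as # L)) = sift1 (hit as ts) v L"
| "sift ts (CNode l r) = join (sift ts l) (sift ts r)"

fun sifts :: "unit trie list list \<Rightarrow> ctree \<Rightarrow> ctree" where
  "sifts [] t = t"
| "sifts (ts # tss) t = sifts tss (sift ts t)"

text \<open>A specification for the proofs: it describes when \<open>sifts\<close> may discard a
  leaf.\<close>

fun hits :: "num list list \<Rightarrow> unit trie list list \<Rightarrow> bool" where
  "hits (as # L) (ts # tss) = (hit as ts \<or> hits L tss)"
| "hits _ _ = False"

lemma cleaves_join: "cleaves (join l r) = cleaves l \<union> cleaves r"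
  by (induction l r rule: join.induct) auto

lemma sift: "(v, L) \<in> cleaves t \<Longrightarrow> (case L of [] \<Rightarrow> (v, L) \<in> cleaves (sift ts t) | as # K \<Rightarrow> hit as ts \<or> (v, K) \<in> cleaves (sift ts t))"
proof (induction t)
  case (CLeaf w K)
  then show ?case by (cases K; cases "hit (hd K) ts") auto
next
  case (CNode l r)
  then show ?case by (cases L) (auto simp: cleaves_join)
qed simp

lemma sifts: "(v, L) \<in> cleaves t \<Longrightarrow> hits L tss \<or> (\<exists>K. (v, K) \<in> cleaves (sifts tss t))"
proof (induction tss arbitrary: L t)
  case (Cons ts tss)
  show ?case
  proof (cases L)
    case Nil
    then show ?thesis using sift[OF Cons(2), of ts] Cons(1)[of L "sift ts t"] by auto
  next
    case (Cons as K)
    then show ?thesis using sift[OF Cons.prems, of ts] Cons.IH[of K "sift ts t"] by auto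
  qed
qed auto

lemma hit: "hit as ts \<longleftrightarrow> (\<exists>(a, t)\<in>set (zip as ts). look t a \<noteq> None)"
proof (induction as arbitrary: ts)
  case (Cons a as)
  show ?case
  proof (cases ts)
    case (Cons t ts')
    then show ?thesis using Cons.IH[of ts'] by (cases "look t a") auto
  qed simp
qed simp

lemma chunks_short: "length xs < 4 \<Longrightarrow> chunks xs = [xs]"
  by (cases xs rule: chunks.cases) auto

text \<open>Lists of equal length have the same block boundaries, so the blocks compare the same
  positions as \<open>zip\<close>.\<close>

lemma hits_chunks:
  "length as = length ts \<Longrightarrow> hits (chunks as) (chunks ts) \<Longrightarrow> \<exists>(a, t)\<in>set (zip as ts). look t a \<noteq> None"
proof (induction "length as" arbitrary: as ts rule: less_induct)
  case less
  show ?case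
  proof (cases "length as < 4")
    case True
    then have "hit as ts" using less.prems by (simp add: chunks_short)
    then show ?thesis by (simp add: hit)
  next
    case False
    then obtain a b c d as' where as: "as = a # b # c # d # as'"
      by (cases as rule: chunks.cases) auto
    with less.prems(1) obtain a2 b2 c2 d2 ts' where ts: "ts = a2 # b2 # c2 # d2 # ts'" "length as' = length ts'"
      by (cases ts rule: chunks.cases) auto
    have "hit [a, b, c, d] [a2, b2, c2, d2] \<or> hits (chunks as') (chunks ts')"
      using less.prems(2) unfolding as ts by (simp only: chunks.simps hits.simps)
    then show ?thesis
    proof
      assume "hit [a, b, c, d] [a2, b2, c2, d2]"
      then show ?thesis unfolding hit as ts by auto
    next
      assume "hits (chunks as') (chunks ts')"
      then have "\<exists>(a, t)\<in>set (zip as' ts'). look t a \<noteq> None" using less.hyps[of as' ts'] as ts(2) by simp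
      then show ?thesis unfolding as ts by auto
    qed
  qed
qed

lemma look_insert_logs: "look (insert_logs n l ys t) a \<noteq> None \<Longrightarrow> look t a \<noteq> None \<or> (\<exists>y\<in>set ys. a = to_num (unwrap n (y - l)))"
proof (induction n l ys t rule: insert_logs.induct)
  case (2 n l y ys t)
  then show ?case by (auto simp: look_ins split: if_splits)
qed simp

text \<open>A hit means that the logarithm of \<open>v\<close> is an excluded \<open>y\<close> minus
  the logarithm of \<open>w\<close>. Then \<open>v * w\<close> is congruent to the power with
  exponent \<open>y\<close>, which \<open>excluded\<close> rules out.\<close>

lemma tries:
  assumes "list_all2 (datum b ps) Is X" "has_logs Is v L" "has_logs Is w K"
    "(a, t) \<in> set (zip (to_nums L) (tries (firsts X) (seconds X) K))" "look t a \<noteq> None"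
  shows "\<not> admissible b (v * w)"
  using assms
proof (induction Is arbitrary: X L K)
  case (Cons I Is)
  obtain x X' where X: "X = x # X'" "datum b ps I x" "list_all2 (datum b ps) Is X'"
    using Cons(2) by (auto simp: list_all2_Cons1)
  obtain l L' where L: "L = l # L'" "is_log I l v" "has_logs Is v L'"
    using Cons(3) by (auto simp: has_logs_def list_all2_Cons1)
  obtain k K' where K: "K = k # K'" "is_log I k w" "has_logs Is w K'"
    using Cons(4) by (auto simp: has_logs_def list_all2_Cons1)
  obtain n ys ls where x: "x = (n, ys, ls)" by (cases x rule: prod_cases3)
  have d: "base_ok I" "n = fst I - 1" "\<forall>y\<in>set ys. excluded b I y" using X(2) by (auto simp: datum_def x)
  have "(a, t) = (to_num l, insert_logs n k ys Tip) \<or> (a, t) \<in> set (zip (to_nums L') (tries (firsts X') (seconds X') K'))"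
    using Cons(5) by (simp add: X L K x)
  then show ?case
  proof
    assume "(a, t) = (to_num l, insert_logs n k ys Tip)"
    then have "look (insert_logs n k ys Tip) (to_num l) \<noteq> None" using Cons(6) by simp
    then obtain y where y: "y \<in> set ys" "to_num l = to_num (unwrap n (y - k))" using look_insert_logs by fastforce
    have ex: "excluded b I y" using d y by blast
    have ly: "is_log I y (snd I ^ nat y)" using ex by (simp add: excluded_def is_log_def)
    note un = is_log_unwrap[OF d(1) ly K(2), folded d(2)]
    have "l > 0" using L(2) by (simp add: is_log_def)
    have "l = unwrap n (y - k)"
      using y(2) numeral_to_num[OF \<open>l > 0\<close>] numeral_to_num[OF un(1)] by metis
    then have "[snd I ^ nat l * w = snd I ^ nat y] (mod fst I)" using un(3) by simp
    moreover have "[snd I ^ nat l * w = v * w] (mod fst I)" using L(2) by (simp add: is_log_def cong_scalar_right)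
    ultimately have "[snd I ^ nat y = v * w] (mod fst I)" using cong_sym cong_trans by blast
    then show ?thesis using ex by (simp add: excluded_def)
  next
    assume "(a, t) \<in> set (zip (to_nums L') (tries (firsts X') (seconds X') K'))"
    then show ?thesis using Cons(1)[OF X(3) L(3) K(3)] Cons(6) by blast
  qed
qed (simp add: has_logs_def)

lemma to_nums_eq: "to_nums L = map to_num L" by (induction L) auto

lemma length_tries: "length ns = length yss \<Longrightarrow> length yss = length ls \<Longrightarrow> length (tries ns yss ls) = length ls"
  by (induction ns yss ls rule: tries.induct) auto

lemma length_fs: "length (firsts X) = length X" "length (seconds X) = length X"
  by (induction X) auto

lemma hits_tries:
  assumes "list_all2 (datum b ps) Is X" "has_logs Is v L" "has_logs Is w K"
    "hits (chunks (to_nums L)) (chunks (tries (firsts X) (seconds X) K))"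
  shows "\<not> admissible b (v * w)"
proof -
  have len: "length X = length Is" "length L = length Is" "length K = length Is"
    using assms(1-3) by (auto simp: has_logs_def dest: list_all2_lengthD)
  then have "length (to_nums L) = length (tries (firsts X) (seconds X) K)"
    by (simp add: to_nums_eq length_tries length_fs)
  from hits_chunks[OF this assms(4)] obtain a t where
    "(a, t) \<in> set (zip (to_nums L) (tries (firsts X) (seconds X) K))" "look t a \<noteq> None" by blast
  then show ?thesis using tries[OF assms(1-3)] by blast
qed

text \<open>Applied to the divisors that the logarithms leave over. The case \<open>u = 2\<close> is
  covered by the sharper test of \<open>C - b\<close> against \<open>bound2 b\<close>.\<close>

fun lin_test :: "int \<Rightarrow> int \<Rightarrow> nat \<Rightarrow> bool" where
  "lin_test b C u = not_dvd (to_num (lin b C u)) (to_num (lin_bound b u))"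

text \<open>Here \<open>e\<close> is the exceptional value $(1 + b)(1 + b + \sqrt b)$ and \<open>n\<close> is the numeral of
  \<open>bound2 b\<close>.\<close>

fun candidate_test :: "int \<Rightarrow> int \<Rightarrow> num \<Rightarrow> int \<Rightarrow> bool" where
  "candidate_test b e n C =
     (if C \<le> (1 + b) * (1 + b) then True else if C = e then True
      else if not_dvd (to_num (C - b)) n then True
      else if lin_test b C 3 then True else if lin_test b C 4 then True
      else if lin_test b C 5 then True else lin_test b C 6)"

fun tree_test :: "int \<Rightarrow> int \<Rightarrow> num \<Rightarrow> int \<Rightarrow> ctree \<Rightarrow> bool" where
  "tree_test b e n w CTip = True"
| "tree_test b e n w (CLeaf v L) = candidate_test b e n (v * w)"
| "tree_test b e n w (CNode l r) = (tree_test b e n w l \<and> tree_test b e n w r)"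

fun pair_test :: "int \<Rightarrow> int \<Rightarrow> num \<Rightarrow> int list \<Rightarrow> int list list \<Rightarrow> ctree \<Rightarrow> tree \<Rightarrow> bool" where
  "pair_test b e n ns yss t (Leaf w K) = tree_test b e n w (sifts (chunks (tries ns yss K)) t)"
| "pair_test b e n ns yss t (Node l r) = (pair_test b e n ns yss t l \<and> pair_test b e n ns yss t r)"

text \<open>The list \<open>ns\<close> doubles as the logarithms of 1: within 1, ..., m - 1 the
  logarithm of 1 is m - 1.\<close>

fun sieve1 :: "int \<Rightarrow> int \<Rightarrow> (int \<times> nat) list \<Rightarrow> (int \<times> nat) list \<Rightarrow> int list \<Rightarrow> int list list \<Rightarrow> int list list \<Rightarrow> bool" where
  "sieve1 b e P Q ns yss lss = pair_test b e (to_num (bound2 b)) ns yss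
     (chunk_tree (divisors ns P lss (Leaf 1 ns))) (divisors ns Q (skip P lss) (Leaf 1 ns))"

fun sieve2 :: "int \<Rightarrow> int \<Rightarrow> (int \<times> nat) list \<Rightarrow> (int \<times> nat) list \<Rightarrow> (int \<times> int list \<times> int list) list \<Rightarrow> bool" where
  "sieve2 b e P Q X = sieve1 b e P Q (firsts X) (seconds X) (thirds X)"

text \<open>A certificate \<open>(b, s, P, Q)\<close> consists of $s = \sqrt b$ if this is an integer and $s = 0$ otherwise, and
  of the prime factorizations of $b^2 (1 + b)^2$ and $(1 + b + b^2)(1 + b^2)$.\<close>

fun sieve :: "(int \<times> num trie) list \<Rightarrow> int \<times> int \<times> (int \<times> nat) list \<times> (int \<times> nat) list \<Rightarrow> bool" where
  "sieve T (b, s, P, Q) = (b > 0 \<and> s \<ge> 0 \<and> (s = 0 \<or> s * s = b) \<and> primes_ok P \<and> primes_ok Q \<and>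
     pp_prod P = b * b * (1 + b) * (1 + b) \<and> pp_prod Q = (1 + b + b * b) * (1 + b * b) \<and>
     sieve2 b ((1 + b) * (1 + b + s)) P Q (useful (prepare b (firsts P @ firsts Q) T)))"

fun sieves1 :: "(int \<times> num trie) list \<Rightarrow> (int \<times> int \<times> (int \<times> nat) list \<times> (int \<times> nat) list) list \<Rightarrow> bool" where
  "sieves1 T [] = True"
| "sieves1 T (c # cs) = (sieve T c \<and> sieves1 T cs)"

fun sieves :: "(int \<times> int) list \<Rightarrow> (int \<times> int \<times> (int \<times> nat) list \<times> (int \<times> nat) list) list \<Rightarrow> bool" where
  "sieves G cs = (gens_ok G \<and> sieves1 (tables G) cs)"

section \<open>Soundness of the sieve\<close>

lemma geo_pos: "b > 0 \<Longrightarrow> geo b (Suc i) > 0"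
  by (induction i) (simp_all add: add_pos_pos)

lemma prodl_pos: "\<forall>x\<in>set xs. x > 0 \<Longrightarrow> prodl xs > 0"
  by (induction xs) simp_all

lemma lin_bound_pos: "b > 0 \<Longrightarrow> lin_bound b u > 0"
proof -
  assume b: "b > 0"
  have "\<forall>x\<in>set (geos b 1 (2 * u + 2)). x > 0"
  proof
    fix x assume "x \<in> set (geos b 1 (2 * u + 2))"
    then obtain k where "x = geo b k" "k \<ge> 1" unfolding geos_1 by (auto simp del: upt_Suc)
    then show "x > 0" using geo_pos[OF b, of "k - 1"] by simp
  qed
  then show ?thesis using b unfolding lin_bound_def by (intro mult_pos_pos zero_less_power prodl_pos) simp_all
qed

lemma bound2_pos: "b > 0 \<Longrightarrow> bound2 b > 0"
proof -
  assume b: "b > 0"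
  have "1 - b + b * b = (b - 1) * (b - 1) + b" by (simp add: algebra_simps)
  moreover have "(b - 1) * (b - 1) + b > 0" using b by (simp add: add_nonneg_pos)
  ultimately have "1 - b + b * b > 0" by simp
  moreover have "geo b 5 > 0" using geo_pos[OF b, of 4] by (simp only: eval_nat_numeral)
  moreover have "1 + b + b * b > 0" "1 + b * b > 0" using b by (simp_all add: add_pos_pos)
  ultimately show ?thesis unfolding bound2_def using b by (intro mult_pos_pos zero_less_power)
qed

lemma lin_test:
  assumes "b > 0" "C > 1 + b" "u \<in> {2..6}" "lin_test b C u"
  shows "\<not> admissible b C"
proof
  assume "admissible b C"
  then have d: "lin b C u dvd lin_bound b u" using assms(3) by (simp add: admissible_def)
  obtain v where v: "u = Suc v" using assms(3) by (cases u) simp_all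
  have "(C - 1 - b) * geo b u > 0" using geo_pos[OF assms(1), of v] assms(2) by (simp add: v)
  then have "lin b C u > 0" using assms(1) by (simp add: lin_def)
  moreover have "lin_bound b u > 0" using assms(1) by (rule lin_bound_pos)
  moreover have "\<not> (numeral (to_num (lin b C u)) :: int) dvd numeral (to_num (lin_bound b u))"
    using assms(4) unfolding lin_test.simps by (rule not_dvd)
  ultimately show False using d by (simp only: numeral_to_num simp_thms)
qed

lemma candidate_test:
  assumes "b > 0" "candidate_test b e (to_num (bound2 b)) C" "admissible b C"
  shows "C \<le> (1 + b) * (1 + b) \<or> C = e"
proof (rule ccontr)
  assume n: "\<not> (C \<le> (1 + b) * (1 + b) \<or> C = e)"
  have "(1 + b) * 1 \<le> (1 + b) * (1 + b)" using assms(1) by (intro mult_left_mono) simp_all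
  also have "\<dots> < C" using n by (simp only: not_le de_Morgan_disj)
  finally have C: "C > 1 + b" by (simp only: mult_1_right)
  have "\<not> not_dvd (to_num (C - b)) (to_num (bound2 b))"
  proof
    assume "not_dvd (to_num (C - b)) (to_num (bound2 b))"
    moreover have "C - b > 0" "bound2 b > 0" using C bound2_pos[OF assms(1)] by simp_all
    ultimately have "\<not> (C - b) dvd bound2 b" using not_dvd[of "to_num (C - b)" "to_num (bound2 b)"]
      by (simp only: numeral_to_num simp_thms)
    then show False using assms(3) by (simp add: admissible_def)
  qed
  then have "lin_test b C 3 \<or> lin_test b C 4 \<or> lin_test b C 5 \<or> lin_test b C 6"
    using assms(2) n by (simp only: candidate_test.simps split: if_splits) blast+
  then show False
    using lin_test[OF assms(1) C, of 3] lin_test[OF assms(1) C, of 4] lin_test[OF assms(1) C, of 5]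
      lin_test[OF assms(1) C, of 6] assms(3) by (elim disjE) (simp_all del: lin_test.simps)
qed

lemma tree_test: "tree_test b e n w t \<Longrightarrow> (v, L) \<in> cleaves t \<Longrightarrow> candidate_test b e n (v * w)"
  by (induction t) auto

lemma pair_test: "pair_test b e n ns yss t s \<Longrightarrow> (w, K) \<in> leaves s \<Longrightarrow> tree_test b e n w (sifts (chunks (tries ns yss K)) t)"
  by (induction s) auto

lemma cleaves_chunk_tree: "(v, L) \<in> leaves t \<Longrightarrow> (v, chunks (to_nums L)) \<in> cleaves (chunk_tree t)"
  by (induction t) auto

lemma datum_lists:
  assumes "list_all2 (datum b ps) Is X"
  shows "\<forall>I\<in>set Is. base_ok I" "firsts X = map (\<lambda>I. fst I - 1) Is" "cols_ok Is (thirds X) ps"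
proof -
  have "(\<forall>I\<in>set Is. base_ok I) \<and> firsts X = map (\<lambda>I. fst I - 1) Is \<and> cols_ok Is (thirds X) ps"
    using assms
  proof (induction Is arbitrary: X)
    case (Cons I Is)
    obtain x X' where X: "X = x # X'" "datum b ps I x" "list_all2 (datum b ps) Is X'"
      using Cons(2) by (auto simp: list_all2_Cons1)
    obtain n ys ls where x: "x = (n, ys, ls)" by (cases x rule: prod_cases3)
    show ?case using Cons(1)[OF X(3)] X(2) by (simp add: X(1) x datum_def cols_ok_def)
  qed (simp add: cols_ok_def)
  then show "\<forall>I\<in>set Is. base_ok I" "firsts X = map (\<lambda>I. fst I - 1) Is" "cols_ok Is (thirds X) ps" by blast+
qed

lemma primes_ok_nonneg: "primes_ok P \<Longrightarrow> \<forall>p\<in>set (firsts P). p \<ge> 0"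
  by (induction P rule: primes_ok.induct) (auto simp: prime_test_def)

lemma has_logs_1: "\<forall>I\<in>set Is. base_ok I \<Longrightarrow> has_logs Is 1 (map (\<lambda>I. fst I - 1) Is)"
proof (induction Is)
  case (Cons I Is)
  have "base_ok I" using Cons(2) by simp
  moreover from this have "fst I > 1" using prime_gt_1_int by (auto simp: base_ok_def)
  ultimately have "is_log I (fst I - 1) 1" using base_ok_1 by (simp add: is_log_def)
  then show ?case using Cons by (simp add: has_logs_def)
qed (simp add: has_logs_def)

text \<open>\<open>C\<close> is split into positive divisors of the two factors, which occur as
  leaves of the two trees. A hit would contradict admissibility, so the first divisor survives the
  sifting by the second, and \<open>candidate_test\<close> holds at \<open>C\<close>.\<close>

lemma sieve:
  assumes T: "\<forall>x\<in>set T. table_ok x" and s: "sieve T (b, s, P, Q)"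
    and C: "C > 0" "C dvd (b * b * (1 + b) * (1 + b)) * ((1 + b + b * b) * (1 + b * b))" "admissible b C"
  shows "C \<le> (1 + b) * (1 + b) \<or> C = (1 + b) * (1 + b + s)"
proof -
  have b: "b > 0" and P: "primes_ok P" "primes_ok Q"
    and prods: "pp_prod P = b * b * (1 + b) * (1 + b)" "pp_prod Q = (1 + b + b * b) * (1 + b * b)"
    using s by simp_all
  define X where "X = useful (prepare b (firsts P @ firsts Q) T)"
  have st: "sieve2 b ((1 + b) * (1 + b + s)) P Q X" using s by (simp add: X_def)
  have "\<forall>p\<in>set (firsts P @ firsts Q). p \<ge> 0" using primes_ok_nonneg P by auto
  then obtain Is where Is: "list_all2 (datum b (firsts P @ firsts Q)) Is X"
    using useful_prepare[OF T b] unfolding X_def by blast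
  note D = datum_lists[OF Is]
  let ?ns = "map (\<lambda>I. fst I - 1) Is"
  let ?S = "divisors ?ns P (thirds X) (Leaf 1 ?ns)" and ?U = "divisors ?ns Q (skip P (thirds X)) (Leaf 1 ?ns)"
  have root: "tree_ok Is (Leaf 1 ?ns)" using has_logs_1[OF D(1)] by (simp add: tree_ok_def)
  have S: "tree_ok Is ?S" "cols_ok Is (skip P (thirds X)) (firsts Q)"
    using tree_ok_divisors[OF D(1) D(3) root] by blast+
  have "cols_ok Is (skip P (thirds X)) (firsts Q @ [])" using S(2) by simp
  from tree_ok_divisors[OF D(1) this root] have U: "tree_ok Is ?U" by blast
  from division_decomp[OF C(2)] obtain c d where cd: "C = c * d" "c dvd pp_prod P" "d dvd pp_prod Q"
    unfolding prods by (elim exE conjE)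
  have "\<bar>C\<bar> = \<bar>c\<bar> * \<bar>d\<bar>" unfolding cd(1) by (rule abs_mult)
  then have Ccd: "C = \<bar>c\<bar> * \<bar>d\<bar>" using C(1) by simp
  have pos: "\<bar>c\<bar> > 0" "\<bar>d\<bar> > 0" using C(1) cd(1) by auto
  have "\<bar>c\<bar> * 1 \<in> fst ` leaves ?S"
    by (rule values_divisors[OF P(1) pos(1)]) (use cd in simp_all)
  then obtain L where L: "(\<bar>c\<bar>, L) \<in> leaves ?S" by auto
  have "\<bar>d\<bar> * 1 \<in> fst ` leaves ?U"
    by (rule values_divisors[OF P(2) pos(2)]) (use cd in simp_all)
  then obtain K where K: "(\<bar>d\<bar>, K) \<in> leaves ?U" by auto
  have hl: "has_logs Is \<bar>c\<bar> L" "has_logs Is \<bar>d\<bar> K" using S(1) U L K by (auto simp: tree_ok_def)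
  have pt: "pair_test b ((1 + b) * (1 + b + s)) (to_num (bound2 b)) (firsts X) (seconds X) (chunk_tree ?S) ?U"
    using st by (simp only: sieve2.simps sieve1.simps D(2))
  have tt: "tree_test b ((1 + b) * (1 + b + s)) (to_num (bound2 b)) \<bar>d\<bar>
      (sifts (chunks (tries (firsts X) (seconds X) K)) (chunk_tree ?S))"
    by (rule pair_test[OF pt K])
  have "\<not> hits (chunks (to_nums L)) (chunks (tries (firsts X) (seconds X) K))"
    using hits_tries[OF Is hl] C(3) unfolding Ccd[symmetric] by blast
  then obtain K' where "(\<bar>c\<bar>, K') \<in> cleaves (sifts (chunks (tries (firsts X) (seconds X) K)) (chunk_tree ?S))"
    using sifts[OF cleaves_chunk_tree[OF L]] by blast
  from tree_test[OF tt this] have "candidate_test b ((1 + b) * (1 + b + s)) (to_num (bound2 b)) C"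
    unfolding Ccd[symmetric] .
  then show ?thesis by (rule candidate_test[OF b _ C(3)])
qed

text \<open>For C = (1 + b)(1 + alpha) the alternatives say alpha <= b and alpha = b + sqrt
  b.\<close>

definition sieved_out :: "int \<Rightarrow> bool" where
  "sieved_out b \<longleftrightarrow> (\<forall>C>0. C dvd (b * b * (1 + b) * (1 + b)) * ((1 + b + b * b) * (1 + b * b)) \<longrightarrow> admissible b C \<longrightarrow>
     C \<le> (1 + b) * (1 + b) \<or> (\<exists>s>0. s * s = b \<and> C = (1 + b) * (1 + b + s)))"

lemma sieves:
  assumes "sieves G cs" "b \<in> set (firsts cs)"
  shows "sieved_out b"
proof -
  have T: "\<forall>x\<in>set (tables G). table_ok x" by (rule tables_ok) (use assms(1) in simp)
  have "sieves1 (tables G) cs" using assms(1) by simp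
  then obtain s P Q where s: "sieve (tables G) (b, s, P, Q)"
    using assms(2) by (induction "tables G" cs rule: sieves1.induct) (auto simp del: sieve.simps)
  have "s \<ge> 0" "s = 0 \<or> s * s = b" using s by simp_all
  \<comment> \<open>For \<open>s = 0\<close> the exceptional value is (1 + b)^2, which the first
    alternative already covers.\<close>
  then have "s = 0 \<or> s > 0 \<and> s * s = b" by linarith
  then show ?thesis using sieve[OF T s] unfolding sieved_out_def by fastforce
qed

section \<open>Divisibilities between the intersection numbers\<close>

lemma geo_add: "geo b (u + k) = geo b u + b ^ u * geo b k"
proof (induction u)
  case (Suc u)
  have "geo b (Suc u + k) = b * geo b (u + k) + 1" by simp
  also have "\<dots> = geo b (Suc u) + b ^ Suc u * geo b k" unfolding Suc.IH by (simp add: algebra_simps)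
  finally show ?case .
qed simp

lemma lin_add: "lin b C (u + k) = lin b C u + (C - 1 - b) * b ^ u * geo b k"
  unfolding lin_def geo_add by (simp only: distrib_left mult.assoc add.assoc)

lemma geo_small:
  "geo b 1 = 1" "geo b 2 = 1 + b" "geo b 3 = 1 + b + b * b" "geo b 4 = (1 + b) * (1 + b * b)"
  "geo b 6 = (1 + b) * (geo b 3 * (1 - b + b * b))"
  by (simp_all add: eval_nat_numeral algebra_simps)

text \<open>The upper half of the product comes from the Gaussian factors of c_{u+2}, ..., c_{2u+2},
  the lower half from reducing their linear factors.\<close>

lemma lin_bound_eq: "lin_bound b u =
    (1 + b) ^ (u + 2) * b ^ (u * (u + 1)) * ((\<Prod>k=1..u + 1. geo b k) * (\<Prod>k=1..u + 1. geo b (u + 1 + k)))"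
proof -
  have p: "prodl (map f xs) = (\<Prod>x\<leftarrow>xs. f x)" for f and xs :: "nat list" by (induction xs) simp_all
  have "prodl (geos b 1 (2 * u + 2)) = (\<Prod>k=1..<2 * u + 2 + 1. geo b k)"
    unfolding geos_1 p by (subst prod.distinct_set_conv_list[symmetric]) (simp_all del: upt_Suc)
  also have "{1..<2 * u + 2 + 1} = {1..u + 1} \<union> {u + 2..2 * u + 2}" by auto
  also have "(\<Prod>k\<in>{1..u + 1} \<union> {u + 2..2 * u + 2}. geo b k) = (\<Prod>k=1..u + 1. geo b k) * (\<Prod>k=u + 2..2 * u + 2. geo b k)"
    by (rule prod.union_disjoint) auto
  also have "(\<Prod>k=u + 2..2 * u + 2. geo b k) = (\<Prod>k=1..u + 1. geo b (u + 1 + k))"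
    by (rule prod.reindex_bij_witness[of _ "\<lambda>k. u + 1 + k" "\<lambda>k. k - (u + 1)"]) auto
  finally show ?thesis unfolding lin_bound_def by (simp only:)
qed

text \<open>Read \<open>a\<close> as 1 + b, \<open>m\<close> as C - 1 - b, \<open>g\<close> as
  \<open>geo b u\<close>, \<open>p\<close> as b^u and \<open>q\<close> as \<open>geo b k\<close>.
  Multiplying \<open>lin b C (u + k)\<close> by \<open>g\<close> is what removes \<open>m\<close>,
  and with it C, from the remainder modulo \<open>lin b C u\<close>.\<close>

lemma lin_identity:
  fixes a g m p q :: int
  shows "(a + m * g + m * p * q) * g - - (a * p * q) = (a + m * g) * (g + p * q)"
  by (simp add: algebra_simps)

text \<open>The arithmetic that remains once the graph is forgotten. The formula for c_{i+1} is
  multiplied by 1 + b because alpha = C / (1 + b) - 1 need not be an integer.\<close>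

locale intersection_numbers =
  fixes b :: int and c :: "nat \<Rightarrow> int" and C :: int
  assumes b: "b > 0" and C: "C = c 2" and c1: "c 1 = 1"
    and c_eq: "\<And>i. i < 14 \<Longrightarrow> (1 + b) * c (Suc i) = geo b (Suc i) * lin b C i"
    and dvd: "\<And>j. 2 \<le> j \<Longrightarrow> j \<le> 7 \<Longrightarrow> (\<Prod>k=1..j. c k) dvd (\<Prod>k=j + 1..2 * j. c k)"
begin

lemma lin_dvd:
  assumes u: "2 \<le> u" "u \<le> 6"
  shows "lin b C u dvd lin_bound b u"
proof -
  let ?L = "lin b C u" and ?I = "{1..u + 1}"
  have "c (u + 1) dvd (\<Prod>k=1..u + 1. c k)" by (rule dvd_prodI) auto
  also have "\<dots> dvd (\<Prod>k=u + 1 + 1..2 * (u + 1). c k)" by (rule dvd) (use u in auto)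
  also have "(\<Prod>k=u + 1 + 1..2 * (u + 1). c k) = (\<Prod>k\<in>?I. c (u + 1 + k))"
    by (rule prod.reindex_bij_witness[of _ "\<lambda>k. u + 1 + k" "\<lambda>k. k - (u + 1)"]) auto
  finally have 1: "c (u + 1) dvd (\<Prod>k\<in>?I. c (u + 1 + k))" .
  have "?L dvd (1 + b) * c (u + 1)" using c_eq[of u] u by simp
  also have "\<dots> dvd (1 + b) * (\<Prod>k\<in>?I. c (u + 1 + k))" using 1 by (rule mult_dvd_mono[OF dvd_refl])
  \<comment> \<open>Enlarging the right-hand side keeps the divisibility. One factor 1 + b per term
    makes \<open>c_eq\<close> applicable, and the factors \<open>geo b u\<close> added below make
    the linear factors reducible.\<close>
  also have "\<dots> dvd (1 + b) * (\<Prod>k\<in>?I. (1 + b) * c (u + 1 + k))"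
    by (intro mult_dvd_mono dvd_refl prod_dvd_prod dvd_triv_right)
  also have "(\<Prod>k\<in>?I. (1 + b) * c (u + 1 + k)) = (\<Prod>k\<in>?I. geo b (u + 1 + k) * lin b C (u + k))"
    by (rule prod.cong) (use c_eq u in auto)
  also have "\<dots> = (\<Prod>k\<in>?I. geo b (u + 1 + k)) * (\<Prod>k\<in>?I. lin b C (u + k))" by (rule prod.distrib)
  also have "(1 + b) * \<dots> dvd (1 + b) * ((\<Prod>k\<in>?I. geo b (u + 1 + k)) * (\<Prod>k\<in>?I. lin b C (u + k) * geo b u))"
    by (intro mult_dvd_mono dvd_refl prod_dvd_prod dvd_triv_left)
  finally have 2: "?L dvd (1 + b) * ((\<Prod>k\<in>?I. geo b (u + 1 + k)) * (\<Prod>k\<in>?I. lin b C (u + k) * geo b u))" .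
  have "[lin b C (u + k) * geo b u = - ((1 + b) * b ^ u * geo b k)] (mod ?L)" for k
  proof -
    have "lin b C (u + k) * geo b u - - ((1 + b) * b ^ u * geo b k) = ?L * (geo b u + b ^ u * geo b k)"
      unfolding lin_add unfolding lin_def by (rule lin_identity)
    then show ?thesis unfolding cong_iff_dvd_diff by simp
  qed
  then have "[(\<Prod>k\<in>?I. lin b C (u + k) * geo b u) = (\<Prod>k\<in>?I. - ((1 + b) * b ^ u * geo b k))] (mod ?L)"
    by (rule cong_prod)
  then have "[(1 + b) * ((\<Prod>k\<in>?I. geo b (u + 1 + k)) * (\<Prod>k\<in>?I. lin b C (u + k) * geo b u)) =
      (1 + b) * ((\<Prod>k\<in>?I. geo b (u + 1 + k)) * (\<Prod>k\<in>?I. - ((1 + b) * b ^ u * geo b k)))] (mod ?L)"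
    by (intro cong_scalar_left)
  then have "?L dvd (1 + b) * ((\<Prod>k\<in>?I. geo b (u + 1 + k)) * (\<Prod>k\<in>?I. - ((1 + b) * b ^ u * geo b k)))"
    using 2 unfolding cong_0_iff[symmetric] by (rule cong_trans[OF cong_sym])
  moreover have P: "(\<Prod>k\<in>?I. - ((1 + b) * b ^ u * geo b k)) = (- ((1 + b) * b ^ u)) ^ (u + 1) * (\<Prod>k\<in>?I. geo b k)"
  proof -
    have "(\<Prod>k\<in>?I. - ((1 + b) * b ^ u * geo b k)) = (\<Prod>k\<in>?I. - ((1 + b) * b ^ u) * geo b k)"
      by (simp only: mult_minus_left)
    also have "\<dots> = (- ((1 + b) * b ^ u)) ^ (u + 1) * (\<Prod>k\<in>?I. geo b k)"
      by (simp only: prod.distrib prod_constant card_atLeastAtMost) simp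
    finally show ?thesis .
  qed
  moreover have X: "(- ((1 + b) * b ^ u)) ^ (u + 1) = (- 1) ^ (u + 1) * ((1 + b) ^ (u + 1) * b ^ (u * (u + 1)))"
    by (simp only: power_minus[of "(1 + b) * b ^ u"] power_mult_distrib power_mult)
  moreover have "(1 + b) ^ (u + 2) = (1 + b) * (1 + b) ^ (u + 1)" by simp
  ultimately have "?L dvd (- 1) ^ (u + 1) * lin_bound b u"
    unfolding lin_bound_eq P X by (simp only: mult_ac)
  then show ?thesis by (cases "even (u + 1)") simp_all
qed

lemma c3: "c 3 = geo b 3 * (C - b)"
proof -
  have "(1 + b) * c 3 = (1 + b) * (geo b 3 * (C - b))"
    using c_eq[of 2] by (simp add: lin_def geo_small eval_nat_numeral algebra_simps)
  then show ?thesis using b by simp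
qed

lemma c4: "c 4 = (1 + b * b) * lin b C 3"
proof -
  have "(1 + b) * c 4 = (1 + b) * ((1 + b * b) * lin b C 3)"
    using c_eq[of 3] geo_small(4)[of b] by (simp add: mult.assoc)
  then show ?thesis using b by simp
qed

lemma c5: "c 5 = geo b 5 * (1 + (C - 1 - b) * (1 + b * b))"
proof -
  have l: "lin b C 4 = (1 + b) * (1 + (C - 1 - b) * (1 + b * b))"
    unfolding lin_def geo_small(4) by (simp only: algebra_simps)
  have "(1 + b) * c 5 = geo b 5 * lin b C 4" using c_eq[of 4] by simp
  also have "\<dots> = (1 + b) * (geo b 5 * (1 + (C - 1 - b) * (1 + b * b)))" unfolding l by (simp only: mult_ac)
  finally show ?thesis using b by simp
qed

lemma c6: "c 6 = geo b 3 * (1 - b + b * b) * lin b C 5"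
proof -
  have "(1 + b) * c 6 = geo b 6 * lin b C 5" using c_eq[of 5] by simp
  also have "\<dots> = (1 + b) * (geo b 3 * (1 - b + b * b) * lin b C 5)" unfolding geo_small(5) by (simp only: mult_ac)
  finally show ?thesis using b by simp
qed

text \<open>c_2 divides c_3 c_4, and modulo \<open>C\<close> the factor \<open>C - b\<close> becomes
  -b while \<open>lin b C 3\<close> becomes -b (1 + b)^2.\<close>

lemma C_dvd: "C dvd (b * b * (1 + b) * (1 + b)) * ((1 + b + b * b) * (1 + b * b))"
proof -
  have "C dvd (\<Prod>k=1..2. c k)" unfolding C by (rule dvd_prodI) auto
  also have "\<dots> dvd (\<Prod>k=2 + 1..2 * 2. c k)" by (rule dvd) auto
  also have "(\<Prod>k=2 + 1..2 * 2. c k) = c 3 * c 4" by (simp add: eval_nat_numeral)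
  finally have "C dvd geo b 3 * (C - b) * ((1 + b * b) * lin b C 3)" unfolding c3 c4 .
  moreover have "geo b 3 * (C - b) * ((1 + b * b) * lin b C 3) =
      (b * b * (1 + b) * (1 + b)) * ((1 + b + b * b) * (1 + b * b)) +
      C * ((1 + b + b * b) * (1 + b * b) * ((C - b) * (1 + b + b * b) - b * (1 + b) * (1 + b)))"
    unfolding lin_def geo_small(3) by (simp add: algebra_simps)
  ultimately show ?thesis by (simp only: dvd_add_left_iff dvd_triv_left)
qed

lemma C_minus_b_dvd: "(C - b) dvd bound2 b"
proof -
  let ?x = "C - b"
  have "?x dvd c 3" unfolding c3 by simp
  also have "c 3 dvd (\<Prod>k=1..3. c k)" by (rule dvd_prodI) auto
  also have "\<dots> dvd (\<Prod>k=3 + 1..2 * 3. c k)" by (rule dvd) auto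
  also have "(\<Prod>k=3 + 1..2 * 3. c k) = c 4 * c 5 * c 6" by (simp add: eval_nat_numeral)
  finally have d: "?x dvd (1 + b * b) * lin b C 3 * (geo b 5 * (1 + (C - 1 - b) * (1 + b * b))) *
      (geo b 3 * (1 - b + b * b) * lin b C 5)" unfolding c4 c5 c6 .
  have m: "C - 1 - b = ?x - 1" by simp
  have g5: "geo b 5 = (1 + b) + b * b * (1 + b + b * b)" by (simp add: eval_nat_numeral algebra_simps)
  have a1: "[lin b C 3 = - (b * b)] (mod ?x)"
    unfolding lin_def geo_small(3) m cong_iff_dvd_diff by (rule dvdI[of _ _ "1 + b + b * b"]) (simp only: algebra_simps)
  have a2: "[1 + (C - 1 - b) * (1 + b * b) = - (b * b)] (mod ?x)"
    unfolding m cong_iff_dvd_diff by (rule dvdI[of _ _ "1 + b * b"]) (simp only: algebra_simps)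
  have a3: "[lin b C 5 = - (b * b * (1 + b + b * b))] (mod ?x)"
    unfolding lin_def g5 m cong_iff_dvd_diff
    by (rule dvdI[of _ _ "(1 + b) + b * b * (1 + b + b * b)"]) (simp only: algebra_simps)
  have "[(1 + b * b) * lin b C 3 * (geo b 5 * (1 + (C - 1 - b) * (1 + b * b))) * (geo b 3 * (1 - b + b * b) * lin b C 5) =
      (1 + b * b) * - (b * b) * (geo b 5 * - (b * b)) * (geo b 3 * (1 - b + b * b) * - (b * b * (1 + b + b * b)))] (mod ?x)"
    by (intro cong_mult cong_refl a1 a2 a3)
  moreover have "(1 + b * b) * - (b * b) * (geo b 5 * - (b * b)) * (geo b 3 * (1 - b + b * b) * - (b * b * (1 + b + b * b))) = - bound2 b"
    unfolding bound2_def geo_small(3) by (simp add: power2_eq_square eval_nat_numeral algebra_simps)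
  ultimately have "[(1 + b * b) * lin b C 3 * (geo b 5 * (1 + (C - 1 - b) * (1 + b * b))) * (geo b 3 * (1 - b + b * b) * lin b C 5) = - bound2 b] (mod ?x)"
    by (simp only:)
  then have "?x dvd - bound2 b" using d unfolding cong_0_iff[symmetric] by (rule cong_trans[OF cong_sym])
  then show ?thesis by simp
qed

lemma admissible: "admissible b C"
  using lin_dvd C_minus_b_dvd by (auto simp: admissible_def)

end

section \<open>The search\<close>

text \<open>The primes from 7 to 113. The primes 2, 3 and 5 would exclude nothing: unless they
  divide \<open>b\<close>, they divide some \<open>geo b k\<close> with \<open>k <= 6\<close>, hence
  every bound. With primitive roots as bases every nonzero residue has a logarithm.\<close>

definition primitive_roots :: "(int \<times> int) list" where
  "primitive_roots = [(7, 3), (11, 2), (13, 2), (17, 3), (19, 2), (23, 5), (29, 2), (31, 3), (37, 2), (41, 6), (43, 3), (47, 5), (53, 2), (59, 2), (61, 2), (67, 2), (71, 7), (73, 5), (79, 3), (83, 2), (89, 3), (97, 5), (101, 2), (103, 5), (107, 2), (109, 6), (113, 3)]"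

definition certified :: "int \<Rightarrow> int \<Rightarrow> (int \<times> int \<times> (int \<times> nat) list \<times> (int \<times> nat) list) list \<Rightarrow> bool" where
  "certified lo hi cs \<longleftrightarrow> firsts cs = [lo..hi] \<and> sieves primitive_roots cs"

lemma certified:
  assumes "certified lo hi cs" "lo \<le> b" "b \<le> hi"
  shows "sieved_out b"
proof (rule sieves)
  show "sieves primitive_roots cs" using assms(1) by (simp only: certified_def)
  have "firsts cs = [lo..hi]" using assms(1) by (simp only: certified_def)
  then show "b \<in> set (firsts cs)" using assms(2,3) by (simp only: set_upto atLeastAtMost_iff simp_thms)
qed

text \<open>Chains the batches: a \<open>b\<close> beyond \<open>hi\<close> is passed on to the
  batch that starts at \<open>hi + 1\<close>.\<close>

lemma certified_upwards:
  "certified lo hi cs \<Longrightarrow> (hi + 1 \<le> b \<Longrightarrow> sieved_out b) \<Longrightarrow> lo \<le> b \<Longrightarrow> sieved_out b"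
  using certified by (cases "b \<le> hi") simp_all

lemma certified_1: "certified 1 10 [
  (1, 1, [(2, 2)], [(2, 1), (3, 1)]),
  (2, 0, [(2, 2), (3, 2)], [(5, 1), (7, 1)]),
  (3, 0, [(2, 4), (3, 2)], [(2, 1), (5, 1), (13, 1)]),
  (4, 2, [(2, 4), (5, 2)], [(3, 1), (7, 1), (17, 1)]),
  (5, 0, [(2, 2), (3, 2), (5, 2)], [(2, 1), (13, 1), (31, 1)]),
  (6, 0, [(2, 2), (3, 2), (7, 2)], [(37, 1), (43, 1)]),
  (7, 0, [(2, 6), (7, 2)], [(2, 1), (3, 1), (5, 2), (19, 1)]),
  (8, 0, [(2, 6), (3, 4)], [(5, 1), (13, 1), (73, 1)]),
  (9, 3, [(2, 2), (3, 4), (5, 2)], [(2, 1), (7, 1), (13, 1), (41, 1)]),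
  (10, 0, [(2, 2), (5, 2), (11, 2)], [(3, 1), (37, 1), (101, 1)])]"
  by code_simp

lemma certified_11: "certified 11 20 [
  (11, 0, [(2, 4), (3, 2), (11, 2)], [(2, 1), (7, 1), (19, 1), (61, 1)]),
  (12, 0, [(2, 4), (3, 2), (13, 2)], [(5, 1), (29, 1), (157, 1)]),
  (13, 0, [(2, 2), (7, 2), (13, 2)], [(2, 1), (3, 1), (5, 1), (17, 1), (61, 1)]),
  (14, 0, [(2, 2), (3, 2), (5, 2), (7, 2)], [(197, 1), (211, 1)]),
  (15, 0, [(2, 8), (3, 2), (5, 2)], [(2, 1), (113, 1), (241, 1)]),
  (16, 4, [(2, 8), (17, 2)], [(3, 1), (7, 1), (13, 1), (257, 1)]),
  (17, 0, [(2, 2), (3, 4), (17, 2)], [(2, 1), (5, 1), (29, 1), (307, 1)]),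
  (18, 0, [(2, 2), (3, 4), (19, 2)], [(5, 2), (7, 3), (13, 1)]),
  (19, 0, [(2, 4), (5, 2), (19, 2)], [(2, 1), (3, 1), (127, 1), (181, 1)]),
  (20, 0, [(2, 4), (3, 2), (5, 2), (7, 2)], [(401, 1), (421, 1)])]"
  by code_simp

lemma certified_21: "certified 21 30 [
  (21, 0, [(2, 2), (3, 2), (7, 2), (11, 2)], [(2, 1), (13, 1), (17, 1), (463, 1)]),
  (22, 0, [(2, 2), (11, 2), (23, 2)], [(3, 1), (5, 1), (13, 2), (97, 1)]),
  (23, 0, [(2, 6), (3, 2), (23, 2)], [(2, 1), (5, 1), (7, 1), (53, 1), (79, 1)]),
  (24, 0, [(2, 6), (3, 2), (5, 4)], [(577, 1), (601, 1)]),
  (25, 5, [(2, 2), (5, 4), (13, 2)], [(2, 1), (3, 1), (7, 1), (31, 1), (313, 1)]),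
  (26, 0, [(2, 2), (3, 6), (13, 2)], [(19, 1), (37, 1), (677, 1)]),
  (27, 0, [(2, 4), (3, 6), (7, 2)], [(2, 1), (5, 1), (73, 1), (757, 1)]),
  (28, 0, [(2, 4), (7, 2), (29, 2)], [(3, 1), (5, 1), (157, 1), (271, 1)]),
  (29, 0, [(2, 2), (3, 2), (5, 2), (29, 2)], [(2, 1), (13, 1), (67, 1), (421, 1)]),
  (30, 0, [(2, 2), (3, 2), (5, 2), (31, 2)], [(7, 2), (17, 1), (19, 1), (53, 1)])]"
  by code_simp

lemma certified_31: "certified 31 40 [
  (31, 0, [(2, 10), (31, 2)], [(2, 1), (3, 1), (13, 1), (37, 1), (331, 1)]),
  (32, 0, [(2, 10), (3, 2), (11, 2)], [(5, 2), (7, 1), (41, 1), (151, 1)]),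
  (33, 0, [(2, 2), (3, 2), (11, 2), (17, 2)], [(2, 1), (5, 1), (109, 1), (1123, 1)]),
  (34, 0, [(2, 2), (5, 2), (7, 2), (17, 2)], [(3, 1), (13, 1), (89, 1), (397, 1)]),
  (35, 0, [(2, 4), (3, 4), (5, 2), (7, 2)], [(2, 1), (13, 1), (97, 1), (613, 1)]),
  (36, 6, [(2, 4), (3, 4), (37, 2)], [(31, 1), (43, 1), (1297, 1)]),
  (37, 0, [(2, 2), (19, 2), (37, 2)], [(2, 1), (3, 1), (5, 1), (7, 1), (67, 1), (137, 1)]),
  (38, 0, [(2, 2), (3, 2), (13, 2), (19, 2)], [(5, 1), (17, 2), (1483, 1)]),
  (39, 0, [(2, 6), (3, 2), (5, 2), (13, 2)], [(2, 1), (7, 1), (223, 1), (761, 1)]),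
  (40, 0, [(2, 6), (5, 2), (41, 2)], [(3, 1), (547, 1), (1601, 1)])]"
  by code_simp

lemma certified_41: "certified 41 50 [
  (41, 0, [(2, 2), (3, 2), (7, 2), (41, 2)], [(2, 1), (29, 2), (1723, 1)]),
  (42, 0, [(2, 2), (3, 2), (7, 2), (43, 2)], [(5, 1), (13, 1), (139, 1), (353, 1)]),
  (43, 0, [(2, 4), (11, 2), (43, 2)], [(2, 1), (3, 1), (5, 2), (37, 1), (631, 1)]),
  (44, 0, [(2, 4), (3, 4), (5, 2), (11, 2)], [(7, 1), (13, 1), (149, 1), (283, 1)]),
  (45, 0, [(2, 2), (3, 4), (5, 2), (23, 2)], [(2, 1), (19, 1), (109, 1), (1013, 1)]),
  (46, 0, [(2, 2), (23, 2), (47, 2)], [(3, 1), (7, 1), (29, 1), (73, 1), (103, 1)]),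
  (47, 0, [(2, 8), (3, 2), (47, 2)], [(2, 1), (5, 1), (13, 1), (17, 1), (37, 1), (61, 1)]),
  (48, 0, [(2, 8), (3, 2), (7, 4)], [(5, 1), (13, 1), (181, 1), (461, 1)]),
  (49, 7, [(2, 2), (5, 4), (7, 4)], [(2, 1), (3, 1), (19, 1), (43, 1), (1201, 1)]),
  (50, 0, [(2, 2), (3, 2), (5, 4), (17, 2)], [(41, 1), (61, 1), (2551, 1)])]"
  by code_simp

lemma certified_51: "certified 51 60 [
  (51, 0, [(2, 4), (3, 2), (13, 2), (17, 2)], [(2, 1), (7, 1), (379, 1), (1301, 1)]),
  (52, 0, [(2, 4), (13, 2), (53, 2)], [(3, 1), (5, 1), (541, 1), (919, 1)]),
  (53, 0, [(2, 2), (3, 6), (53, 2)], [(2, 1), (5, 1), (7, 1), (281, 1), (409, 1)]),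
  (54, 0, [(2, 2), (3, 6), (5, 2), (11, 2)], [(2917, 1), (2971, 1)]),
  (55, 0, [(2, 6), (5, 2), (7, 2), (11, 2)], [(2, 1), (3, 1), (13, 1), (17, 1), (79, 1), (89, 1)]),
  (56, 0, [(2, 6), (3, 2), (7, 2), (19, 2)], [(31, 1), (103, 1), (3137, 1)]),
  (57, 0, [(2, 2), (3, 2), (19, 2), (29, 2)], [(2, 1), (5, 3), (13, 1), (3307, 1)]),
  (58, 0, [(2, 2), (29, 2), (59, 2)], [(3, 1), (5, 1), (7, 1), (163, 1), (673, 1)]),
  (59, 0, [(2, 4), (3, 2), (5, 2), (59, 2)], [(2, 1), (1741, 1), (3541, 1)]),
  (60, 0, [(2, 4), (3, 2), (5, 2), (61, 2)], [(7, 1), (13, 1), (277, 1), (523, 1)])]"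
  by code_simp

lemma certified_61: "certified 61 70 [
  (61, 0, [(2, 2), (31, 2), (61, 2)], [(2, 1), (3, 1), (13, 1), (97, 1), (1861, 1)]),
  (62, 0, [(2, 2), (3, 4), (7, 2), (31, 2)], [(5, 1), (769, 1), (3907, 1)]),
  (63, 0, [(2, 12), (3, 4), (7, 2)], [(2, 1), (5, 1), (37, 1), (109, 1), (397, 1)]),
  (64, 8, [(2, 12), (5, 2), (13, 2)], [(3, 1), (17, 1), (19, 1), (73, 1), (241, 1)]),
  (65, 0, [(2, 2), (3, 2), (5, 2), (11, 2), (13, 2)], [(2, 1), (7, 1), (613, 1), (2113, 1)]),
  (66, 0, [(2, 2), (3, 2), (11, 2), (67, 2)], [(4357, 1), (4423, 1)]),
  (67, 0, [(2, 4), (17, 2), (67, 2)], [(2, 1), (3, 1), (5, 1), (7, 2), (31, 1), (449, 1)]),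
  (68, 0, [(2, 4), (3, 2), (17, 2), (23, 2)], [(5, 3), (13, 1), (19, 2), (37, 1)]),
  (69, 0, [(2, 2), (3, 2), (5, 2), (7, 2), (23, 2)], [(2, 1), (2381, 1), (4831, 1)]),
  (70, 0, [(2, 2), (5, 2), (7, 2), (71, 2)], [(3, 1), (13, 2), (29, 1), (1657, 1)])]"
  by code_simp

lemma certified_71: "certified 71 80 [
  (71, 0, [(2, 6), (3, 4), (71, 2)], [(2, 1), (2521, 1), (5113, 1)]),
  (72, 0, [(2, 6), (3, 4), (73, 2)], [(5, 1), (7, 1), (17, 1), (61, 1), (751, 1)]),
  (73, 0, [(2, 2), (37, 2), (73, 2)], [(2, 1), (3, 1), (5, 1), (13, 1), (41, 1), (1801, 1)]),
  (74, 0, [(2, 2), (3, 2), (5, 4), (37, 2)], [(7, 1), (13, 1), (61, 1), (5477, 1)]),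
  (75, 0, [(2, 4), (3, 2), (5, 4), (19, 2)], [(2, 1), (29, 1), (97, 1), (5701, 1)]),
  (76, 0, [(2, 4), (7, 2), (11, 2), (19, 2)], [(3, 1), (53, 1), (109, 1), (1951, 1)]),
  (77, 0, [(2, 2), (3, 2), (7, 2), (11, 2), (13, 2)], [(2, 1), (5, 1), (593, 1), (6007, 1)]),
  (78, 0, [(2, 2), (3, 2), (13, 2), (79, 2)], [(5, 1), (1217, 1), (6163, 1)]),
  (79, 0, [(2, 8), (5, 2), (79, 2)], [(2, 1), (3, 1), (7, 2), (43, 1), (3121, 1)]),
  (80, 0, [(2, 8), (3, 8), (5, 2)], [(37, 1), (173, 1), (6481, 1)])]"
  by code_simp

lemma certified_81: "certified 81 90 [
  (81, 9, [(2, 2), (3, 8), (41, 2)], [(2, 1), (7, 1), (13, 1), (17, 1), (73, 1), (193, 1)]),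
  (82, 0, [(2, 2), (41, 2), (83, 2)], [(3, 1), (5, 2), (269, 1), (2269, 1)]),
  (83, 0, [(2, 4), (3, 2), (7, 2), (83, 2)], [(2, 1), (5, 1), (13, 1), (19, 1), (53, 1), (367, 1)]),
  (84, 0, [(2, 4), (3, 2), (5, 2), (7, 2), (17, 2)], [(37, 1), (193, 1), (7057, 1)]),
  (85, 0, [(2, 2), (5, 2), (17, 2), (43, 2)], [(2, 1), (3, 1), (2437, 1), (3613, 1)]),
  (86, 0, [(2, 2), (3, 2), (29, 2), (43, 2)], [(7, 1), (13, 1), (569, 1), (1069, 1)]),
  (87, 0, [(2, 6), (3, 2), (11, 2), (29, 2)], [(2, 1), (5, 1), (13, 1), (19, 1), (31, 1), (757, 1)]),
  (88, 0, [(2, 6), (11, 2), (89, 2)], [(3, 1), (5, 1), (7, 1), (373, 1), (1549, 1)]),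
  (89, 0, [(2, 2), (3, 4), (5, 2), (89, 2)], [(2, 1), (17, 1), (233, 1), (8011, 1)]),
  (90, 0, [(2, 2), (3, 4), (5, 2), (7, 2), (13, 2)], [(8101, 1), (8191, 1)])]"
  by code_simp

lemma certified_91: "certified 91 100 [
  (91, 0, [(2, 4), (7, 2), (13, 2), (23, 2)], [(2, 1), (3, 1), (41, 1), (101, 1), (2791, 1)]),
  (92, 0, [(2, 4), (3, 2), (23, 2), (31, 2)], [(5, 1), (43, 1), (199, 1), (1693, 1)]),
  (93, 0, [(2, 2), (3, 2), (31, 2), (47, 2)], [(2, 1), (5, 2), (7, 1), (173, 1), (1249, 1)]),
  (94, 0, [(2, 2), (5, 2), (19, 2), (47, 2)], [(3, 1), (13, 1), (229, 1), (8837, 1)]),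
  (95, 0, [(2, 10), (3, 2), (5, 2), (19, 2)], [(2, 1), (7, 1), (1303, 1), (4513, 1)]),
  (96, 0, [(2, 10), (3, 2), (97, 2)], [(13, 1), (67, 1), (139, 1), (709, 1)]),
  (97, 0, [(2, 2), (7, 4), (97, 2)], [(2, 1), (3, 1), (5, 1), (941, 1), (3169, 1)]),
  (98, 0, [(2, 2), (3, 4), (7, 4), (11, 2)], [(5, 1), (17, 1), (31, 1), (113, 1), (313, 1)]),
  (99, 0, [(2, 4), (3, 4), (5, 4), (11, 2)], [(2, 1), (13, 2), (29, 1), (9901, 1)]),
  (100, 10, [(2, 4), (5, 4), (101, 2)], [(3, 1), (7, 1), (13, 1), (37, 1), (73, 1), (137, 1)])]"
  by code_simp

lemma sieved_out:
  assumes "b \<in> {1..100}"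
  shows "sieved_out b"
  by (rule certified_upwards[OF certified_1],
      rule certified_upwards[OF certified_11],
      rule certified_upwards[OF certified_21],
      rule certified_upwards[OF certified_31],
      rule certified_upwards[OF certified_41],
      rule certified_upwards[OF certified_51],
      rule certified_upwards[OF certified_61],
      rule certified_upwards[OF certified_71],
      rule certified_upwards[OF certified_81],
      rule certified_upwards[OF certified_91]) (use assms in simp_all)

lemma gauss1_eq: "gauss1 b i = real_of_int (geo b i)"
proof (induction i)
  case (Suc i)
  have "gauss1 b (Suc i) = 1 + (\<Sum>k<i. real_of_int b ^ Suc k)"
    unfolding gauss1_def by (subst sum.lessThan_Suc_shift) simp
  also have "\<dots> = 1 + real_of_int b * gauss1 b i" by (simp add: gauss1_def sum_distrib_left)
  finally show ?case using Suc by simp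
qed (simp add: gauss1_def)

theorem theorem1p3:
  fixes \<Gamma> :: "'a pair_pre_digraph" and D :: nat and b :: int and \<alpha> \<beta> :: real
  assumes "has_classical_parameters \<Gamma> D b \<alpha> \<beta>"
    and "b \<in> {1..100}"
    and "D \<ge> 14"
  shows "(\<not> is_square b \<longrightarrow> \<alpha> \<le> real_of_int b) \<and>
         (is_square b \<longrightarrow> \<alpha> \<le> real_of_int b \<or> \<alpha> = real_of_int b + sqrt (real_of_int b))"
proof -
  have diam: "graph_diameter \<Gamma> = D" and reg: "distance_regular \<Gamma>"
    using assms(1) by (auto simp: has_classical_parameters_def)
  obtain bs cs where I: "has_intersection_numbers \<Gamma> bs cs"
    and cs: "\<And>i. i \<le> D \<Longrightarrow> real_of_int (cs i) = gauss1 b i * (1 + \<alpha> * gauss1 b (i - 1))"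
    using assms(1) by (auto simp: has_classical_parameters_def)
  interpret connected_pair_graph \<Gamma>
    using reg by (simp add: distance_regular_def connected_pair_graph_def connected_pair_graph_axioms_def)
  have b: "b > 0" using assms(2) by simp
  \<comment> \<open>Since 1 + b is positive, c_2 determines alpha, and bounds on the integer c_2
    carry over.\<close>
  have cs2: "real_of_int (cs 2) = (1 + real_of_int b) * (1 + \<alpha>)"
    using cs[of 2] assms(3) by (simp add: gauss1_eq geo_small numeral_2_eq_2)
  interpret intersection_numbers b cs "cs 2"
  proof
    show "b > 0" by (rule b)
    show "cs 2 = cs 2" ..
    have "real_of_int (cs 1) = 1" using cs[of 1] assms(3) by (simp add: gauss1_eq)
    then show "cs 1 = 1" by simp
    show "(1 + b) * cs (Suc i) = geo b (Suc i) * lin b (cs 2) i" if "i < 14" for i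
    proof -
      have "real_of_int ((1 + b) * cs (Suc i)) = (1 + real_of_int b) * (real_of_int (geo b (Suc i)) * (1 + \<alpha> * real_of_int (geo b i)))"
        using cs[of "Suc i"] that assms(3) by (simp add: gauss1_eq)
      \<comment> \<open>The product (1 + b) alpha is expressed as c_2 - 1 - b, an integer.\<close>
      also have "\<dots> = real_of_int (geo b (Suc i)) * ((1 + real_of_int b) + ((1 + real_of_int b) * (1 + \<alpha>) - 1 - real_of_int b) * real_of_int (geo b i))"
        by (simp only: algebra_simps)
      also have "\<dots> = real_of_int (geo b (Suc i) * lin b (cs 2) i)" unfolding cs2[symmetric] by (simp add: lin_def)
      finally show ?thesis by (simp only: of_int_eq_iff)
    qed
    show "(\<Prod>k=1..j. cs k) dvd (\<Prod>k=j + 1..2 * j. cs k)" if "2 \<le> j" "j \<le> 7" for j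
      by (rule prod_c_dvd[OF I]) (use that diam assms(3) in simp)
  qed
  have "cs 2 > 0" using c_pos[OF I, of 2] diam assms(3) by simp
  then consider "cs 2 \<le> (1 + b) * (1 + b)" | s where "s > 0" "s * s = b" "cs 2 = (1 + b) * (1 + b + s)"
    using sieved_out[OF assms(2)] C_dvd admissible unfolding sieved_out_def by blast
  then show ?thesis
  proof cases
    case 1
    then have "real_of_int (cs 2) \<le> real_of_int ((1 + b) * (1 + b))"
      by (simp only: of_int_le_iff)
    then have "(1 + real_of_int b) * (1 + \<alpha>) \<le> (1 + real_of_int b) * (1 + real_of_int b)"
      by (simp only: cs2 of_int_mult of_int_add of_int_1)
    moreover have "1 + real_of_int b > 0" using b by simp
    ultimately have "1 + \<alpha> \<le> 1 + real_of_int b" by (rule mult_left_le_imp_le)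
    then show ?thesis by simp
  next
    case 2
    have "(1 + real_of_int b) * (1 + \<alpha>) = (1 + real_of_int b) * (1 + real_of_int b + real_of_int s)"
      unfolding cs2[symmetric] 2(3) by simp
    moreover have "1 + real_of_int b \<noteq> 0" using b by simp
    ultimately have "1 + \<alpha> = 1 + real_of_int b + real_of_int s" by (metis mult_cancel_left)
    then have "\<alpha> = real_of_int b + real_of_int s" by simp
    moreover have "sqrt (real_of_int b) = real_of_int s"
      unfolding 2(2)[symmetric] of_int_mult real_sqrt_abs2 using 2(1) by simp
    moreover have "is_square b" unfolding is_nth_power_def power2_eq_square 2(2)[symmetric] by blast
    ultimately show ?thesis by simp
  qed
qed

end
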